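(* Let $\Phi=\{f_i(x)=A_ix+t_i\}_{i\in\mathcal{A}}$ be a dominated planar IFS of affinities with affinity dimension $s_0\in(1,2]$. Let $X$ be the attractor of $\Phi$, let $X_F\subset\mathbb{RP}^1$ be the set of Furstenberg directions, let $\mu_K$ be the Käenmäki measure and let $\pi\colon\Sigma\to X$ be the natural projection. If $\mathcal{H}^{s_0}(X)>0$ then (i) there exists a constant $C>0$ such that $(\mathrm{proj}_V)_*\pi_*\mu_K(B(t,r))\leq C\cdot r$ for every $V\in X_F$, $t\in \mathrm{proj}_V(X)$ and $r>0$; (ii) there exists $C>0$ such that for every $V\in X_F$ and for every $t\in \mathrm{proj}_V(X)$, $\mathcal{H}^{s_0-1}(X\cap\mathrm{proj}_V^{-1}(t))\leq C$.
   Context: Planar IFS of affinities: $\mathcal{A}$ is a finite index set and $f_i(x)=A_ix+t_i$ on $\mathbb{R}^2$ with $A_i$ a real $2\times2$ matrix, $\|A_i\|<1$, $\det A_i\neq0$, $t_i\in\mathbb{R}^2$. The attractor $X$ is the unique non-empty compact set with $X=\bigcup_{i\in\mathcal{A}}f_i(X)$. Words: $\Sigma=\mathcal{A}^{\mathbb{N}}$ (product topology), $\Sigma_*=\bigcup_{n\ge0}\mathcal{A}^n$; $|\mathbf{i}|$ is the length of $\mathbf{i}$; $\mathbf{i}|_n$ is the prefix of length $n$; $[\mathbf{i}]\subset\Sigma$ is the cylinder of infinite words with prefix $\mathbf{i}\in\Sigma_*$; the left shift is $\sigma$. For $\mathbf{i}=(i_1,\dots,i_n)$: $f_{\mathbf{i}}=f_{i_1}\circ\cdots\circ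 f_{i_n}$, $A_{\mathbf{i}}=A_{i_1}\cdots A_{i_n}$, and $A^*_{\mathbf{i}}:=A_{i_1}^*\cdots A_{i_n}^*$ (product of transposes in this order). The natural projection is $\pi(\mathbf{i})=\lim_{n}f_{\mathbf{i}|_n}(0)$. Affinity dimension: with $\alpha_1(A)\ge\alpha_2(A)$ the singular values, $\varphi^s(A)=\alpha_1(A)^s$ for $0\le s\le1$, $\varphi^s(A)=\alpha_1(A)\alpha_2(A)^{s-1}$ for $1< s\le2$, $\varphi^s(A)=|\det A|^{s/2}$ for $s>2$; $s_0=\inf\{s>0:\sum_{n\ge1}\sum_{\mathbf{i}\in\mathcal{A}^n}\varphi^s(A_{\mathbf{i}})<\infty\}$. Dominated: there are $C>0$, $0<\tau<1$ with $\alpha_2(A_{\mathbf{i}})\le C\tau^{|\mathbf{i}|}\alpha_1(A_{\mathbf{i}})$ for all $\mathbf{i}\in\Sigma_*$. Equivalently (Bochi–Gourmelon), there is a strongly invariant multicone: a non-empty proper subset $\mathcal{C}\subset\mathbb{RP}^1$ that is a finite union of closed projective intervals, with $\bigcup_{i}A_i^*\mathcal{C}\subseteq\mathcal{C}^o$ (interior). Fix such $\mathcal{C}$; the Furstenberg directions are $X_F=\bigcap_{n\ge0}\bigcup_{|\mathbf{i}|=n}A^*_{\mathbf{i}}\mathcal{C}$. Käenmäki measure: under domination, $\mu_K$ is the unique left-shift invariant ergodic Borel probability measure on $\Sigma$ for which there is $c>0$ with $c^{-1}\varphi^{s_0}(A_{\mathbf{i}})\le\mu_K([\mathbf{i}])\le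 c\,\varphi^{s_0}(A_{\mathbf{i}})$ for all $\mathbf{i}\in\Sigma_*$. $\mathcal{H}^s$ is Hausdorff measure, normalized as $\lim_{\delta\to0}\mathcal{H}^s_\delta$ with $\mathcal{H}^s_\delta(A)=\inf\{\sum_i|U_i|^s:A\subseteq\bigcup_iU_i,\ |U_i|<\delta\}$ ($|U|$ = diameter). For $V\in\mathbb{RP}^1$ (a line through the origin), $\mathrm{proj}_V\colon\mathbb{R}^2\to V$ is orthogonal projection; $B(t,r)$ is the ball in $V$ of radius $r$ centred at $t$. *)

theory Defs
  imports "HOL-Analysis.Analysis" "HOL-Probability.Probability"
begin

text \<open>The alphabet is a type \<open>'i::finite\<close>; \<open>\<Sigma>\<close> is \<open>nat \<Rightarrow> 'i\<close> (indexed from 0) and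
  \<open>\<Sigma>\<^sub>*\<close> is \<open>'i list\<close>.\<close>

definition prefix_word :: "(nat \<Rightarrow> 'i) \<Rightarrow> nat \<Rightarrow> 'i list" where
  "prefix_word x n = map x [0..<n]"

definition cylinder :: "'i list \<Rightarrow> (nat \<Rightarrow> 'i) set" where
  "cylinder w = {x. prefix_word x (length w) = w}"

definition left_shift :: "(nat \<Rightarrow> 'i) \<Rightarrow> nat \<Rightarrow> 'i" where
  "left_shift x = (\<lambda>n. x (Suc n))"

definition symbolic_topology :: "(nat \<Rightarrow> 'i) topology" where
  "symbolic_topology = product_topology (\<lambda>_. discrete_topology UNIV) UNIV"

definition symbolic_borel :: "(nat \<Rightarrow> 'i) measure" where
  "symbolic_borel = sigma UNIV {U. openin symbolic_topology U}"

definition affine_map :: "('i \<Rightarrow> real^2^2) \<Rightarrow> ('i \<Rightarrow> real^2) \<Rightarrow> 'i \<Rightarrow> real^2 \<Rightarrow> real^2" where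
  "affine_map A t i x = A i *v x + t i"

definition word_map :: "('i \<Rightarrow> real^2^2) \<Rightarrow> ('i \<Rightarrow> real^2) \<Rightarrow> 'i list \<Rightarrow> real^2 \<Rightarrow> real^2" where
  "word_map A t w = foldr (\<lambda>i g. affine_map A t i \<circ> g) w id"

definition word_matrix :: "('i \<Rightarrow> real^2^2) \<Rightarrow> 'i list \<Rightarrow> real^2^2" where
  "word_matrix A w = foldr (\<lambda>i M. A i ** M) w (mat 1)"

text \<open>The transposes are multiplied in the order of the word, so this is not the transpose of
  \<open>word_matrix A w\<close>.\<close>

definition word_transposes :: "('i \<Rightarrow> real^2^2) \<Rightarrow> 'i list \<Rightarrow> real^2^2" where
  "word_transposes A = word_matrix (\<lambda>i. transpose (A i))"

definition is_attractor :: "('i \<Rightarrow> real^2^2) \<Rightarrow> ('i \<Rightarrow> real^2) \<Rightarrow> (real^2) set \<Rightarrow> bool" where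
  "is_attractor A t X \<longleftrightarrow> X \<noteq> {} \<and> compact X \<and> X = (\<Union>i. affine_map A t i ` X)"

definition natural_projection ::
    "('i \<Rightarrow> real^2^2) \<Rightarrow> ('i \<Rightarrow> real^2) \<Rightarrow> (nat \<Rightarrow> 'i) \<Rightarrow> real^2" where
  "natural_projection A t x = lim (\<lambda>n. word_map A t (prefix_word x n) 0)"

text \<open>Singular values are the square roots of the eigenvalues of \<open>M\<^sup>T M\<close>. If there is only one
  eigenvalue it is double, as the matrices are \<open>2 \<times> 2\<close>, so the two definitions below also agree
  with the ordering with multiplicity.\<close>

definition gram_eigenvalues :: "real^2^2 \<Rightarrow> real set" where
  "gram_eigenvalues M = {l. \<exists>v. v \<noteq> 0 \<and> (transpose M ** M) *v v = l *\<^sub>R v}"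

definition alpha1 :: "real^2^2 \<Rightarrow> real" where
  "alpha1 M = sqrt (Max (gram_eigenvalues M))"

definition alpha2 :: "real^2^2 \<Rightarrow> real" where
  "alpha2 M = sqrt (Min (gram_eigenvalues M))"

definition singular_value_function :: "real \<Rightarrow> real^2^2 \<Rightarrow> real" where
  "singular_value_function s M =
     (if s \<le> 1 then alpha1 M powr s
      else if s \<le> 2 then alpha1 M * alpha2 M powr (s - 1)
      else \<bar>det M\<bar> powr (s / 2))"

text \<open>All terms are nonnegative, so summability of the series indexed by the length (starting at
  length 1) is finiteness of the double sum.\<close>

definition affinity_dimension :: "('i::finite \<Rightarrow> real^2^2) \<Rightarrow> real" where
  "affinity_dimension A =
     Inf {s. s > 0 \<and> summable (\<lambda>n. \<Sum>w | length w = Suc n.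
                                      singular_value_function s (word_matrix A w))}"

definition dominated :: "('i \<Rightarrow> real^2^2) \<Rightarrow> bool" where
  "dominated A \<longleftrightarrow>
     (\<exists>C \<tau>. C > 0 \<and> 0 < \<tau> \<and> \<tau> < 1 \<and>
        (\<forall>w. alpha2 (word_matrix A w) \<le> C * \<tau> ^ length w * alpha1 (word_matrix A w)))"

definition RP1 :: "(real^2) set set" where
  "RP1 = {V. subspace V \<and> dim V = 1}"

text \<open>The quotient topology with respect to \<open>v \<mapsto> span {v}\<close> on the nonzero vectors.\<close>

definition RP1_topology :: "(real^2) set topology" where
  "RP1_topology = topology (\<lambda>U. U \<subseteq> RP1 \<and> open {v. v \<noteq> 0 \<and> span {v} \<in> U})"

lemma openin_RP1_topology:
  "openin RP1_topology U \<longleftrightarrow> U \<subseteq> RP1 \<and> open {v. v \<noteq> 0 \<and> span {v} \<in> U}"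
proof -
  have "istopology (\<lambda>U. U \<subseteq> RP1 \<and> open {v::real^2. v \<noteq> 0 \<and> span {v} \<in> U})"
    unfolding istopology_def
  proof (intro conjI allI impI)
    fix S T
    assume S: "S \<subseteq> RP1 \<and> open {v::real^2. v \<noteq> 0 \<and> span {v} \<in> S}"
      and T: "T \<subseteq> RP1 \<and> open {v::real^2. v \<noteq> 0 \<and> span {v} \<in> T}"
    have "{v::real^2. v \<noteq> 0 \<and> span {v} \<in> S \<inter> T} =
        {v. v \<noteq> 0 \<and> span {v} \<in> S} \<inter> {v. v \<noteq> 0 \<and> span {v} \<in> T}" by auto
    then show "open {v::real^2. v \<noteq> 0 \<and> span {v} \<in> S \<inter> T}" using S T by auto
    show "S \<inter> T \<subseteq> RP1" using S by auto
  next
    fix K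
    assume K: "\<forall>S\<in>K. S \<subseteq> RP1 \<and> open {v::real^2. v \<noteq> 0 \<and> span {v} \<in> S}"
    have "{v::real^2. v \<noteq> 0 \<and> span {v} \<in> \<Union>K} = (\<Union>S\<in>K. {v. v \<noteq> 0 \<and> span {v} \<in> S})" by auto
    then show "open {v::real^2. v \<noteq> 0 \<and> span {v} \<in> \<Union>K}" using K by auto
    show "\<Union>K \<subseteq> RP1" using K by auto
  qed
  then show ?thesis by (simp add: RP1_topology_def)
qed

definition line_at :: "real \<Rightarrow> (real^2) set" where
  "line_at \<theta> = span {vector [cos \<theta>, sin \<theta>]}"

definition projective_action :: "real^2^2 \<Rightarrow> (real^2) set \<Rightarrow> (real^2) set" where
  "projective_action M V = (\<lambda>v. M *v v) ` V"

text \<open>The whole of \<open>RP1\<close> (\<open>b - a \<ge> \<pi>\<close>) is not excluded here, but it is excluded in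
  \<open>strongly_invariant_multicone\<close> by properness.\<close>

definition closed_projective_interval :: "(real^2) set set \<Rightarrow> bool" where
  "closed_projective_interval I \<longleftrightarrow> (\<exists>a b. a \<le> b \<and> I = line_at ` {a..b})"

definition strongly_invariant_multicone ::
    "('i \<Rightarrow> real^2^2) \<Rightarrow> (real^2) set set \<Rightarrow> bool" where
  "strongly_invariant_multicone A \<C> \<longleftrightarrow>
     \<C> \<noteq> {} \<and> \<C> \<subset> RP1 \<and>
     (\<exists>\<I>. finite \<I> \<and> (\<forall>I\<in>\<I>. closed_projective_interval I) \<and> \<C> = \<Union>\<I>) \<and>
     (\<Union>i. projective_action (transpose (A i)) ` \<C>) \<subseteq> RP1_topology interior_of \<C>"

definition furstenberg_directions ::
    "('i \<Rightarrow> real^2^2) \<Rightarrow> (real^2) set set \<Rightarrow> (real^2) set set" where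
  "furstenberg_directions A \<C> =
     (\<Inter>n. \<Union>w\<in>{w. length w = n}. projective_action (word_transposes A w) ` \<C>)"

definition orth_proj :: "(real^2) set \<Rightarrow> real^2 \<Rightarrow> real^2" where
  "orth_proj V x = (THE y. y \<in> V \<and> (\<forall>v\<in>V. orthogonal (x - y) v))"

definition shift_invariant :: "(nat \<Rightarrow> 'i) measure \<Rightarrow> bool" where
  "shift_invariant \<mu> \<longleftrightarrow> (\<forall>E\<in>sets \<mu>. emeasure \<mu> (left_shift -` E) = emeasure \<mu> E)"

definition shift_ergodic :: "(nat \<Rightarrow> 'i) measure \<Rightarrow> bool" where
  "shift_ergodic \<mu> \<longleftrightarrow>
     (\<forall>E\<in>sets \<mu>. left_shift -` E = E \<longrightarrow> measure \<mu> E = 0 \<or> measure \<mu> E = 1)"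

definition kaenmaki_measure :: "('i::finite \<Rightarrow> real^2^2) \<Rightarrow> (nat \<Rightarrow> 'i) measure \<Rightarrow> bool" where
  "kaenmaki_measure A \<mu> \<longleftrightarrow>
     prob_space \<mu> \<and> sets \<mu> = sets symbolic_borel \<and> shift_invariant \<mu> \<and> shift_ergodic \<mu> \<and>
     (\<exists>c>0. \<forall>w.
        inverse c * singular_value_function (affinity_dimension A) (word_matrix A w)
          \<le> measure \<mu> (cylinder w) \<and>
        measure \<mu> (cylinder w)
          \<le> c * singular_value_function (affinity_dimension A) (word_matrix A w))"

text \<open>Covers are countable. Boundedness is demanded because \<open>diameter\<close> is only meaningful
  for bounded sets. Finite covers are included by padding with empty sets, which contribute
  \<open>0 powr s = 0\<close>. Since \<open>0 powr 0 = 0\<close>, the definition is the intended one only for \<open>s > 0\<close>.\<close>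

definition hausdorff_content :: "real \<Rightarrow> 'a::metric_space set \<Rightarrow> real \<Rightarrow> ennreal" where
  "hausdorff_content s S \<delta> =
     Inf {\<Sum>i. ennreal (diameter (U i) powr s) | U :: nat \<Rightarrow> 'a set.
            S \<subseteq> (\<Union>i. U i) \<and> (\<forall>i. bounded (U i) \<and> diameter (U i) < \<delta>)}"

definition hausdorff_measure :: "real \<Rightarrow> 'a::metric_space set \<Rightarrow> ennreal" where
  "hausdorff_measure s S = Lim (at_right 0) (hausdorff_content s S)"

end

theory Submission
  imports Defs
begin

text \<open>If a tube of width \<open>r\<close> around a line orthogonal to a Furstenberg direction has measure much
  larger than \<open>r\<close>, take a word \<open>v\<close> whose expanding direction is within \<open>r\<close> of it. For every word
  \<open>w\<close> the map of \<open>wv\<close> flattens the tube along its length, so that the part of the attractor in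
  the tube has an image with a cover costing at most a constant times \<open>r \<mu>[wv]\<close>, which is much
  less than the measure of the image. By quasi-multiplicativity of the measure these images fill a
  fixed proportion of every cylinder \<open>[w]\<close>; iterating in the remaining cylinders gives covers of
  \<open>X\<close> with arbitrarily small cost as the tube gets heavier, against the positivity of the
  Hausdorff measure. The slices are then covered by the pieces of projected size about \<open>r\<close> which
  they meet: such a piece contributes \<open>\<alpha>\<^sub>2\<close> to the power \<open>s - 1\<close>, about \<open>\<mu>[w] / r\<close>, and all of
  them lie in a tube of width about \<open>r\<close>.\<close>

section \<open>Planar linear algebra\<close>

text \<open>Positivity of the Hausdorff measure enters through a contradiction: covers of
  \<open>X\<close> of cost at most \<open>2 * K'\<close> at every scale \<open>\<delta>\<close>
  cannot exist once \<open>2 * K'\<close> lies below the measure. The obstacle is that a heavy tube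
  sits at one place and one scale \<open>r\<close>, whereas the covers must be cheap everywhere and
  have arbitrarily small pieces. Copying the tube by \<open>f w\<close> alone would not do, since
  \<open>f w\<close> flattens it only if it runs along the direction that \<open>M w\<close>
  contracts most, and this direction varies with \<open>w\<close>. Inserting \<open>v\<close> cures
  this. The direction that governs \<open>w @ v\<close> is that of
  \<open>transpose (M v) *v (transpose (M w) *v y)\<close>: here \<open>transpose (M v)\<close> acts
  last and pinches the whole cone to within about \<open>\<rho> v\<close> of the normal of the tube,
  whatever \<open>w\<close> is. Furstenberg directions are those reached by such \<open>v\<close> at
  every length. Inserting \<open>v\<close> costs only a factor \<open>m v\<close> in the proportion
  filled; this slows the iteration down but does not enter the final constant
  \<open>K\<^sub>1 / (q\<^sub>0 * K')\<close>.\<close>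

abbreviation opnorm :: "real^2^2 \<Rightarrow> real" where
  "opnorm M \<equiv> onorm (\<lambda>x. M *v x)"

text \<open>The signed area of the parallelogram on \<open>x\<close> and \<open>y\<close>. It
  vanishes only on dependent pairs and is scaled by \<open>det M\<close> under \<open>M\<close>,
  which makes it the gauge of angles between lines throughout.\<close>

definition cross2 :: "real^2 \<Rightarrow> real^2 \<Rightarrow> real" where
  "cross2 x y = x$1 * y$2 - x$2 * y$1"

lemma inner_2: "x \<bullet> y = x$1 * y$1 + x$2 * y$2" for x y :: "real^2"
  by (simp add: inner_vec_def sum_2)

lemma norm_2_sq: "(norm x)\<^sup>2 = (x$1)\<^sup>2 + (x$2)\<^sup>2" for x :: "real^2"
  unfolding power2_norm_eq_inner by (simp add: inner_2 power2_eq_square)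

lemma mult_vec_2: "(M *v x)$i = M$i$1 * x$1 + M$i$2 * x$2" for M :: "real^2^2"
  by (simp add: matrix_vector_mult_def sum_2)

lemma norm_mult_vec_le: "norm (M *v x) \<le> opnorm M * norm x" for M :: "real^2^2"
  by (rule onorm) simp

lemma opnorm_nonneg: "0 \<le> opnorm M"
  by (rule onorm_pos_le) simp

lemma opnorm_le: "(\<And>x. norm (M *v x) \<le> b * norm x) \<Longrightarrow> opnorm M \<le> b"
  by (rule onorm_le)

lemma opnorm_mult: "opnorm (M ** N) \<le> opnorm M * opnorm N"
  using onorm_compose[of "(*v) M" "(*v) N"] by (simp add: comp_def matrix_vector_mul_assoc)

lemma opnorm_transpose: "opnorm (transpose M) = opnorm M"
proof -
  have le: "opnorm (transpose M) \<le> opnorm M" for M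
  proof (rule opnorm_le)
    fix x
    have "(norm (transpose M *v x))\<^sup>2 = x \<bullet> (M *v (transpose M *v x))"
      by (simp add: power2_norm_eq_inner dot_lmul_matrix[symmetric])
    also have "\<dots> \<le> norm x * norm (M *v (transpose M *v x))" by (rule norm_cauchy_schwarz)
    also have "\<dots> \<le> norm x * (opnorm M * norm (transpose M *v x))"
      by (intro mult_left_mono norm_mult_vec_le) simp
    finally have "norm (transpose M *v x) * norm (transpose M *v x)
        \<le> (opnorm M * norm x) * norm (transpose M *v x)"
      by (simp add: power2_eq_square mult_ac)
    then show "norm (transpose M *v x) \<le> opnorm M * norm x"
      using opnorm_nonneg[of M]
      by (cases "norm (transpose M *v x) = 0") (auto dest: mult_right_le_imp_le)
  qed
  show ?thesis using le[of M] le[of "transpose M"] by simp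
qed

lemma opnorm_mat_1: "opnorm (mat 1) = 1"
proof -
  have "onorm (\<lambda>x::real^2. x) = 1" by (rule onorm_id)
  then show ?thesis by simp
qed

lemma det_eq_0_iff_kernel: "det M = 0 \<longleftrightarrow> (\<exists>x. x \<noteq> 0 \<and> M *v x = 0)" for M :: "real^2^2"
  by (metis invertible_det_nz invertible_left_inverse matrix_left_invertible_ker)

lemma opnorm_pos: "det M \<noteq> 0 \<Longrightarrow> 0 < opnorm M"
proof -
  assume "det M \<noteq> 0"
  moreover have "axis 1 1 \<noteq> (0 :: real^2)" by (simp add: axis_eq_0_iff)
  ultimately have "M *v axis 1 1 \<noteq> 0" using det_eq_0_iff_kernel[of M] by blast
  then have "opnorm M \<noteq> 0" using norm_mult_vec_le[of M "axis 1 1"] by auto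
  then show ?thesis using opnorm_nonneg[of M] by linarith
qed

lemma cross2_lagrange: "(cross2 x y)\<^sup>2 + (x \<bullet> y)\<^sup>2 = (norm x)\<^sup>2 * (norm y)\<^sup>2"
  unfolding norm_2_sq by (simp add: inner_2 cross2_def power2_eq_square algebra_simps)

lemma abs_cross2_le: "\<bar>cross2 x y\<bar> \<le> norm x * norm y"
proof -
  have "(cross2 x y)\<^sup>2 \<le> (norm x * norm y)\<^sup>2"
    using cross2_lagrange[of x y] by (simp add: power_mult_distrib) (smt (verit) zero_le_power2)
  then show ?thesis by (metis abs_le_square_iff abs_of_nonneg norm_ge_zero mult_nonneg_nonneg)
qed

lemma cross2_mult: "cross2 (M *v x) (M *v y) = det M * cross2 x y"
  by (simp add: cross2_def mult_vec_2 det_2 algebra_simps)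

lemma cross2_eq_0_span:
  assumes "cross2 x y = 0" "y \<noteq> 0" shows "\<exists>c. x = c *\<^sub>R y"
proof -
  have "x = ((x \<bullet> y) / (norm y)\<^sup>2) *\<^sub>R y"
  proof -
    have n: "(norm y)\<^sup>2 \<noteq> 0" using assms by simp
    have "(norm y)\<^sup>2 * x$i = (x \<bullet> y) * y$i" for i
    proof -
      have "(norm y)\<^sup>2 * x$1 = (x \<bullet> y) * y$1 + cross2 x y * y$2"
        "(norm y)\<^sup>2 * x$2 = (x \<bullet> y) * y$2 - cross2 x y * y$1"
        unfolding norm_2_sq by (simp_all add: cross2_def inner_2 power2_eq_square algebra_simps)
      then show ?thesis using assms(1) exhaust_2[of i] by auto
    qed
    then have "x$i = (x \<bullet> y) * y$i / (norm y)\<^sup>2" for i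
      using n by (metis nonzero_mult_div_cancel_left)
    then show ?thesis by (simp add: vec_eq_iff)
  qed
  then show ?thesis by blast
qed

text \<open>\<open>x\<close> is split along the unit vector \<open>e\<close> and its normal. This
  transfers a bound on the extent of a set in direction \<open>e\<close> to a nearby direction, at
  the cost of the angle times the diameter.\<close>

lemma abs_inner_rotate_le:
  assumes "norm e = 1"
  shows "\<bar>x \<bullet> z\<bar> \<le> norm x * \<bar>e \<bullet> z\<bar> + \<bar>cross2 x e\<bar> * norm z"
proof -
  have "(norm e)\<^sup>2 * (x \<bullet> z) = (x \<bullet> e) * (e \<bullet> z) - cross2 x e * cross2 e z"
    unfolding norm_2_sq by (simp add: inner_2 cross2_def power2_eq_square algebra_simps)
  then have "\<bar>x \<bullet> z\<bar> \<le> \<bar>x \<bullet> e\<bar> * \<bar>e \<bullet> z\<bar> + \<bar>cross2 x e\<bar> * \<bar>cross2 e z\<bar>"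
    using assms by (simp flip: abs_mult)
  also have "\<dots> \<le> norm x * \<bar>e \<bullet> z\<bar> + \<bar>cross2 x e\<bar> * norm z"
    using Cauchy_Schwarz_ineq2[of x e] abs_cross2_le[of e z] assms
    by (intro add_mono mult_mono) auto
  finally show ?thesis .
qed

text \<open>Let \<open>e = transpose M *v y\<close> and let \<open>J\<close> be the quarter turn. As
  \<open>M\<close>, \<open>J\<close> and \<open>transpose M\<close> multiply to \<open>det M\<close>
  times \<open>J\<close>, the part of \<open>z\<close> orthogonal to \<open>e\<close> is stretched
  only by \<open>\<bar>det M\<bar> * norm y / norm e\<close>. This is why a tube with normal
  \<open>e\<close> is flattened along its length.\<close>

lemma norm_image_tube_le:
  fixes M :: "real^2^2"
  shows "norm (transpose M *v y) * norm (M *v z)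
    \<le> \<bar>(transpose M *v y) \<bullet> z\<bar> * opnorm M + \<bar>det M\<bar> * norm y * norm z"
proof (cases "transpose M *v y = 0")
  case False
  define e where "e = transpose M *v y"
  define J :: "real^2 \<Rightarrow> real^2" where "J x = vector [- x$2, x$1]" for x
  have nJ: "norm (J x) = norm x" for x
    unfolding J_def norm_eq_sqrt_inner inner_2 by (simp add: add.commute)
  have "(norm e)\<^sup>2 *\<^sub>R (M *v z) = (e \<bullet> z) *\<^sub>R (M *v e) + (cross2 e z * det M) *\<^sub>R J y"
  proof -
    have e: "e$1 = M$1$1 * y$1 + M$2$1 * y$2" "e$2 = M$1$2 * y$1 + M$2$2 * y$2"
      unfolding e_def by (simp_all add: mult_vec_2 transpose_def)
    have "((norm e)\<^sup>2 *\<^sub>R (M *v z))$i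
        = ((e \<bullet> z) *\<^sub>R (M *v e) + (cross2 e z * det M) *\<^sub>R J y)$i" for i
      using exhaust_2[of i]
    proof
      assume i: "i = 1"
      show ?thesis unfolding i
norm_2_sq
        by (simp add: J_def inner_2 cross2_def mult_vec_2 det_2 e)
          (simp add: algebra_simps power2_eq_square)
    next
      assume i: "i = 2"
      show ?thesis unfolding i
norm_2_sq
        by (simp add: J_def inner_2 cross2_def mult_vec_2 det_2 e)
          (simp add: algebra_simps power2_eq_square)
    qed
    then show ?thesis by (simp add: vec_eq_iff)
  qed
  then have "(norm e)\<^sup>2 * norm (M *v z)
      = norm ((e \<bullet> z) *\<^sub>R (M *v e) + (cross2 e z * det M) *\<^sub>R J y)"
    by (metis abs_power2 norm_scaleR)
  also have "\<dots> \<le> \<bar>e \<bullet> z\<bar> * norm (M *v e) + \<bar>cross2 e z\<bar> * \<bar>det M\<bar> * norm y"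
    by (rule order_trans[OF norm_triangle_ineq]) (simp add: nJ abs_mult)
  also have "\<dots> \<le> \<bar>e \<bullet> z\<bar> * (opnorm M * norm e) + (norm e * norm z) * \<bar>det M\<bar> * norm y"
    by (intro add_mono mult_left_mono mult_right_mono norm_mult_vec_le abs_cross2_le) auto
  finally have "norm e * (norm e * norm (M *v z))
      \<le> norm e * (\<bar>e \<bullet> z\<bar> * opnorm M + \<bar>det M\<bar> * norm y * norm z)"
    by (simp add: power2_eq_square algebra_simps)
  then show ?thesis using False unfolding e_def by (simp add: mult_le_cancel_left)
qed (simp add: opnorm_nonneg)

text \<open>\<open>p\<close> is the trace of the Gram matrix, so its eigenvalues are the roots of
  \<open>l\<^sup>2 - p * l + (det M)\<^sup>2\<close>; the discriminant is a sum of two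
  squares.\<close>

lemma gram_eigenvalues_eq:
  fixes M :: "real^2^2"
  defines "p \<equiv> (M$1$1)\<^sup>2 + (M$1$2)\<^sup>2 + (M$2$1)\<^sup>2 + (M$2$2)\<^sup>2"
  defines "R \<equiv> sqrt (p\<^sup>2 - 4 * (det M)\<^sup>2)"
  shows "gram_eigenvalues M = {(p + R) / 2, (p - R) / 2}" and "p\<^sup>2 - 4 * (det M)\<^sup>2 \<ge> 0"
proof -
  have "p\<^sup>2 - 4 * (det M)\<^sup>2 = ((M$1$1)\<^sup>2 + (M$2$1)\<^sup>2 - (M$1$2)\<^sup>2 - (M$2$2)\<^sup>2)\<^sup>2
      + 4 * (M$1$1 * M$1$2 + M$2$1 * M$2$2)\<^sup>2"
    by (simp add: p_def det_2 power2_eq_square algebra_simps)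
  then show nn: "p\<^sup>2 - 4 * (det M)\<^sup>2 \<ge> 0" by simp
  have R2: "R\<^sup>2 = p\<^sup>2 - 4 * (det M)\<^sup>2" unfolding R_def using nn by simp
  have "l \<in> gram_eigenvalues M \<longleftrightarrow> l\<^sup>2 - p * l + (det M)\<^sup>2 = 0" for l
  proof -
    have "l \<in> gram_eigenvalues M
        \<longleftrightarrow> (\<exists>v. v \<noteq> 0 \<and> (transpose M ** M - l *\<^sub>R mat 1) *v v = 0)"
      unfolding gram_eigenvalues_def
      by (simp add: matrix_vector_mult_diff_rdistrib scaleR_matrix_vector_assoc[symmetric])
    also have "\<dots> \<longleftrightarrow> det (transpose M ** M - l *\<^sub>R mat 1) = 0"
      by (rule det_eq_0_iff_kernel[symmetric])
    also have "det (transpose M ** M - l *\<^sub>R mat 1) = l\<^sup>2 - p * l + (det M)\<^sup>2"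
      unfolding p_def det_2
      by (simp add: matrix_matrix_mult_def sum_2 transpose_def mat_def power2_eq_square algebra_simps)
    finally show ?thesis .
  qed
  moreover have "l\<^sup>2 - p * l + (det M)\<^sup>2 = 0 \<longleftrightarrow> l = (p + R) / 2 \<or> l = (p - R) / 2" for l
  proof -
    have "l\<^sup>2 - p * l + (det M)\<^sup>2 = (l - (p + R) / 2) * (l - (p - R) / 2)"
      using R2 by (simp add: field_simps power2_eq_square)
    then show ?thesis by simp
  qed
  ultimately show "gram_eigenvalues M = {(p + R) / 2, (p - R) / 2}" by auto
qed

lemma
  fixes M :: "real^2^2"
  shows alpha1_eq_opnorm: "alpha1 M = opnorm M"
    and alpha1_mult_alpha2: "alpha1 M * alpha2 M = \<bar>det M\<bar>"
proof -
  define p where "p = (M$1$1)\<^sup>2 + (M$1$2)\<^sup>2 + (M$2$1)\<^sup>2 + (M$2$2)\<^sup>2"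
  define R where "R = sqrt (p\<^sup>2 - 4 * (det M)\<^sup>2)"
  define l where "l = (p + R) / 2"
  have ev: "gram_eigenvalues M = {l, (p - R) / 2}" and nn: "p\<^sup>2 - 4 * (det M)\<^sup>2 \<ge> 0"
    unfolding l_def using gram_eigenvalues_eq[of M] unfolding p_def R_def by auto
  have R0: "0 \<le> R" and R2: "R\<^sup>2 = p\<^sup>2 - 4 * (det M)\<^sup>2" unfolding R_def using nn by auto
  have a1: "alpha1 M = sqrt l" unfolding alpha1_def ev using R0 by (simp add: l_def max_def)
  have a2: "alpha2 M = sqrt ((p - R) / 2)"
    unfolding alpha2_def ev using R0 by (simp add: l_def min_def)
  have "l * ((p - R) / 2) = (det M)\<^sup>2"
    unfolding l_def using R2 by (simp add: field_simps power2_eq_square)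
  then show "alpha1 M * alpha2 M = \<bar>det M\<bar>"
    unfolding a1 a2 by (metis real_sqrt_abs real_sqrt_mult)
  have eig_norm: "(norm (M *v v))\<^sup>2 = m * (norm v)\<^sup>2"
    if "(transpose M ** M) *v v = m *\<^sub>R v" for v m
  proof -
    have "(norm (M *v v))\<^sup>2 = (transpose M *v (M *v v)) \<bullet> v"
      unfolding power2_norm_eq_inner transpose_matrix_vector dot_lmul_matrix ..
    also have "\<dots> = (m *\<^sub>R v) \<bullet> v" unfolding matrix_vector_mul_assoc that ..
    finally show ?thesis by (simp add: power2_norm_eq_inner)
  qed
  obtain v where v: "v \<noteq> 0" "(transpose M ** M) *v v = l *\<^sub>R v"
    using ev unfolding gram_eigenvalues_def by blast
  \<comment> \<open>\<open>a\<close>, \<open>d\<close> and \<open>b\<close> are the entries of the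
    Gram matrix. As \<open>l\<close> is its larger eigenvalue, \<open>l\<close> minus the Gram
    matrix has determinant 0 and nonnegative diagonal, hence a nonnegative quadratic form.\<close>
  have up: "(norm (M *v x))\<^sup>2 \<le> l * (norm x)\<^sup>2" for x
  proof -
    define a where "a = (M$1$1)\<^sup>2 + (M$2$1)\<^sup>2"
    define d where "d = (M$1$2)\<^sup>2 + (M$2$2)\<^sup>2"
    define b where "b = M$1$1 * M$1$2 + M$2$1 * M$2$2"
    have pad: "p = a + d" unfolding p_def a_def d_def by simp
    have R2': "R\<^sup>2 = (a - d)\<^sup>2 + 4 * b\<^sup>2"
      unfolding R2 by (simp add: p_def a_def d_def b_def det_2 power2_eq_square algebra_simps)
    have "\<bar>a - d\<bar> \<le> R" by (rule power2_le_imp_le) (simp_all add: R2' R0)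
    then have la: "a \<le> l" and ld: "d \<le> l" unfolding l_def pad by auto
    have prod: "(l - a) * (l - d) = b\<^sup>2"
      unfolding l_def pad using R2' by (simp add: field_simps power2_eq_square)
    have "(l - a) * (x$1)\<^sup>2 - 2 * b * x$1 * x$2 + (l - d) * (x$2)\<^sup>2 \<ge> 0"
    proof -
      have "2 * (b * (x$1 * x$2)) \<le> 2 * \<bar>sqrt (l - a) * sqrt (l - d)\<bar> * \<bar>x$1 * x$2\<bar>"
      proof -
        have "\<bar>b\<bar> = sqrt (l - a) * sqrt (l - d)" using prod by (metis real_sqrt_abs real_sqrt_mult)
        moreover have "b * (x$1 * x$2) \<le> \<bar>b\<bar> * \<bar>x$1 * x$2\<bar>" by (metis abs_ge_self abs_mult)
        ultimately show ?thesis by simp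
      qed
      also have "\<dots> = 2 * \<bar>sqrt (l - a) * x$1\<bar> * \<bar>sqrt (l - d) * x$2\<bar>"
        by (simp add: abs_mult)
      also have "\<dots> \<le> (sqrt (l - a) * x$1)\<^sup>2 + (sqrt (l - d) * x$2)\<^sup>2"
        using sum_squares_bound[of "\<bar>sqrt (l - a) * x$1\<bar>" "\<bar>sqrt (l - d) * x$2\<bar>"] by simp
      also have "\<dots> = (l - a) * (x$1)\<^sup>2 + (l - d) * (x$2)\<^sup>2"
        using la ld by (simp add: power_mult_distrib)
      finally show ?thesis by (simp add: algebra_simps)
    qed
    moreover have "(norm (M *v x))\<^sup>2 = a * (x$1)\<^sup>2 + 2 * b * x$1 * x$2 + d * (x$2)\<^sup>2"
      unfolding norm_2_sq by (simp add: mult_vec_2 a_def b_def d_def power2_eq_square algebra_simps)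
    ultimately show ?thesis unfolding norm_2_sq[of x] by (simp add: algebra_simps)
  qed
  have "opnorm M \<le> sqrt l"
  proof (rule opnorm_le)
    fix x
    show "norm (M *v x) \<le> sqrt l * norm x"
      using real_sqrt_le_mono[OF up[of x]] by (simp add: real_sqrt_mult)
  qed
  moreover have "sqrt l \<le> opnorm M"
  proof -
    have "norm (M *v v) = sqrt l * norm v"
      using arg_cong[OF eig_norm[OF v(2)], of sqrt] by (simp add: real_sqrt_mult)
    then show ?thesis using norm_mult_vec_le[of M v] v(1) by simp
  qed
  ultimately show "alpha1 M = opnorm M" unfolding a1 by simp
qed

text \<open>One factor is now a power of the submultiplicative norm, the other a power of the
  multiplicative determinant, both with nonnegative exponents; only the norm remains to be
  controlled under concatenation.\<close>

lemma singular_value_function_eq: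
  assumes "1 < s" "s \<le> 2" "det M \<noteq> 0"
  shows "singular_value_function s M = opnorm M powr (2 - s) * \<bar>det M\<bar> powr (s - 1)"
proof -
  have pos: "0 < opnorm M" by (rule opnorm_pos[OF assms(3)])
  have "alpha2 M = \<bar>det M\<bar> / opnorm M"
    using alpha1_mult_alpha2[of M] pos by (simp add: alpha1_eq_opnorm field_simps)
  then have "singular_value_function s M = opnorm M * (\<bar>det M\<bar> powr (s - 1) / opnorm M powr (s - 1))"
    unfolding singular_value_function_def using assms pos
    by (simp add: alpha1_eq_opnorm powr_divide)
  also have "\<dots> = opnorm M powr (2 - s) * \<bar>det M\<bar> powr (s - 1)"
    using pos powr_diff[of "opnorm M" 1 "s - 1"] by simp
  finally show ?thesis .
qed

section \<open>Covers and Hausdorff measure\<close>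

text \<open>Hausdorff measures are only ever bounded from above, for which finite covers suffice. An
  explicit real cost lets covers be glued and refined without handling infima.\<close>

definition finite_cover_le :: "real \<Rightarrow> real \<Rightarrow> 'a::metric_space set \<Rightarrow> real \<Rightarrow> bool" where
  "finite_cover_le s \<delta> S c \<longleftrightarrow>
     (\<exists>\<U>. finite \<U> \<and> S \<subseteq> \<Union>\<U> \<and> (\<forall>U\<in>\<U>. bounded U \<and> diameter U < \<delta>) \<and>
        (\<Sum>U\<in>\<U>. diameter U powr s) \<le> c)"

lemma hausdorff_content_antimono:
  "\<delta> \<le> \<delta>' \<Longrightarrow> hausdorff_content s S \<delta>' \<le> hausdorff_content s S \<delta>"
  unfolding hausdorff_content_def
proof (rule Inf_superset_mono, rule Collect_mono, rule impI)
  fix x assume le: "\<delta> \<le> \<delta>'" and "\<exists>U. x = (\<Sum>i. ennreal (diameter (U i) powr s)) \<and>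
      S \<subseteq> (\<Union>i. U i) \<and> (\<forall>i. bounded (U i) \<and> diameter (U i) < \<delta>)"
  then obtain U where U: "x = (\<Sum>i. ennreal (diameter (U i) powr s))" "S \<subseteq> (\<Union>i. U i)"
      "\<And>i. bounded (U i) \<and> diameter (U i) < \<delta>"
    by blast
  show "\<exists>U. x = (\<Sum>i. ennreal (diameter (U i) powr s)) \<and>
      S \<subseteq> (\<Union>i. U i) \<and> (\<forall>i. bounded (U i) \<and> diameter (U i) < \<delta>')"
    by (rule exI[of _ U]) (use U le less_le_trans in blast)
qed

text \<open>Shrinking \<open>\<delta>\<close> leaves fewer covers, so the content grows and the
  limit behind \<open>Lim\<close> exists.\<close>

lemma hausdorff_measure_eq_SUP:
  "hausdorff_measure s S = (SUP \<delta>\<in>{0<..}. hausdorff_content s S \<delta>)"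
proof -
  have "(hausdorff_content s S \<longlongrightarrow> (SUP \<delta>\<in>{0<..}. hausdorff_content s S \<delta>)) (at_right 0)"
  proof (rule order_tendstoI)
    fix a assume "a < (SUP \<delta>\<in>{0<..}. hausdorff_content s S \<delta>)"
    then obtain d where d: "0 < d" "a < hausdorff_content s S d" by (auto simp: less_SUP_iff)
    have "\<forall>\<^sub>F x in at_right 0. x < d" using d(1) unfolding eventually_at_right_field by blast
    then show "\<forall>\<^sub>F x in at_right 0. a < hausdorff_content s S x"
    proof (rule eventually_mono)
      fix x assume "x < d"
      then show "a < hausdorff_content s S x"
        using d(2) hausdorff_content_antimono[of x d s S] by (meson less_imp_le less_le_trans)
    qed
  next
    fix a assume a: "(SUP \<delta>\<in>{0<..}. hausdorff_content s S \<delta>) < a"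
    have "\<forall>\<^sub>F x in at_right (0::real). 0 < x" by (rule eventually_at_right_less)
    then show "\<forall>\<^sub>F x in at_right 0. hausdorff_content s S x < a"
    proof (rule eventually_mono)
      fix x :: real assume "0 < x"
      then show "hausdorff_content s S x < a" using SUP_lessD[OF a] by simp
    qed
  qed
  then show ?thesis unfolding hausdorff_measure_def by (intro tendsto_Lim) auto
qed

lemma hausdorff_content_le_finite_cover:
  assumes "finite_cover_le s \<delta> S c" "\<delta> > 0"
  shows "hausdorff_content s S \<delta> \<le> ennreal c"
proof -
  obtain \<U> where \<U>: "finite \<U>" "S \<subseteq> \<Union>\<U>" "\<And>U. U \<in> \<U> \<Longrightarrow> bounded U \<and> diameter U < \<delta>"
      "(\<Sum>U\<in>\<U>. diameter U powr s) \<le> c"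
    using assms(1) unfolding finite_cover_le_def by blast
  obtain h where h: "bij_betw h {0..<card \<U>} \<U>" using ex_bij_betw_nat_finite[OF \<U>(1)] by blast
  \<comment> \<open>Empty sets pad the finite family to a sequence; they are admissible since
    \<open>\<delta> > 0\<close> and cost \<open>0 powr s = 0\<close>.\<close>
  define W where "W i = (if i < card \<U> then h i else {})" for i
  have "S \<subseteq> (\<Union>i. W i)"
  proof
    fix x assume "x \<in> S"
    then obtain U where "U \<in> \<U>" "x \<in> U" using \<U>(2) by blast
    then obtain i where "i < card \<U>" "h i = U" using h by (metis atLeastLessThan_iff bij_betw_iff_bijections)
    then show "x \<in> (\<Union>i. W i)" using \<open>x \<in> U\<close> by (auto simp: W_def intro!: exI[of _ i])
  qed
  moreover have "bounded (W i) \<and> diameter (W i) < \<delta>" for i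
    using \<U>(3)[of "h i"] bij_betwE[OF h] assms(2) by (simp add: W_def)
  ultimately have "hausdorff_content s S \<delta> \<le> (\<Sum>i. ennreal (diameter (W i) powr s))"
    unfolding hausdorff_content_def by (intro Inf_lower) auto
  also have "\<dots> = (\<Sum>i\<in>{0..<card \<U>}. ennreal (diameter (W i) powr s))"
    by (rule suminf_finite) (auto simp: W_def)
  also have "\<dots> = (\<Sum>i\<in>{0..<card \<U>}. ennreal (diameter (h i) powr s))"
    by (rule sum.cong) (auto simp: W_def)
  also have "\<dots> = (\<Sum>U\<in>\<U>. ennreal (diameter U powr s))"
    using sum.reindex_bij_betw[OF h] .
  also have "\<dots> = ennreal (\<Sum>U\<in>\<U>. diameter U powr s)" by (rule sum_ennreal) simp
  also have "\<dots> \<le> ennreal c" using \<U>(4) by (rule ennreal_leI)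
  finally show ?thesis .
qed

lemma hausdorff_measure_le_finite_cover:
  assumes "\<And>\<delta>. 0 < \<delta> \<Longrightarrow> finite_cover_le s \<delta> S c"
  shows "hausdorff_measure s S \<le> ennreal c"
  unfolding hausdorff_measure_eq_SUP
  by (rule SUP_least) (simp add: assms hausdorff_content_le_finite_cover)

lemma finite_cover_le_mono:
  "finite_cover_le s \<delta> T c \<Longrightarrow> S \<subseteq> T \<Longrightarrow> c \<le> d \<Longrightarrow> finite_cover_le s \<delta> S d"
  unfolding finite_cover_le_def by (meson order_trans)

lemma finite_cover_leI:
  assumes "finite K" "S \<subseteq> (\<Union>k\<in>K. U k)" "\<And>k. k \<in> K \<Longrightarrow> bounded (U k) \<and> diameter (U k) < \<delta>"
    and "(\<Sum>k\<in>K. diameter (U k) powr s) \<le> c"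
  shows "finite_cover_le s \<delta> S c"
proof -
  have "(\<Sum>V\<in>U ` K. diameter V powr s) \<le> (\<Sum>k\<in>K. ((\<lambda>V. diameter V powr s) \<circ> U) k)"
    by (rule sum_image_le) (use assms(1) in auto)
  then have "(\<Sum>V\<in>U ` K. diameter V powr s) \<le> c" using assms(4) by (simp add: comp_def)
  moreover have "\<forall>V\<in>U ` K. bounded V \<and> diameter V < \<delta>" using assms(3) by blast
  moreover have "finite (U ` K)" using assms(1) by (rule finite_imageI)
  ultimately show ?thesis using assms(2) unfolding finite_cover_le_def by blast
qed

lemma finite_cover_le_UN:
  assumes "finite I" "\<And>i. i \<in> I \<Longrightarrow> finite_cover_le s \<delta> (S i) (c i)"
  shows "finite_cover_le s \<delta> (\<Union>i\<in>I. S i) (\<Sum>i\<in>I. c i)"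
proof -
  have "\<forall>i\<in>I. \<exists>\<U>. finite \<U> \<and> S i \<subseteq> \<Union>\<U> \<and> (\<forall>U\<in>\<U>. bounded U \<and> diameter U < \<delta>) \<and>
      (\<Sum>U\<in>\<U>. diameter U powr s) \<le> c i"
    using assms(2) unfolding finite_cover_le_def by simp
  from bchoice[OF this] obtain \<U> where "\<forall>i\<in>I. finite (\<U> i) \<and> S i \<subseteq> \<Union>(\<U> i) \<and>
      (\<forall>U\<in>\<U> i. bounded U \<and> diameter U < \<delta>) \<and> (\<Sum>U\<in>\<U> i. diameter U powr s) \<le> c i" ..
  then have \<U>: "\<And>i. i \<in> I \<Longrightarrow> finite (\<U> i) \<and> S i \<subseteq> \<Union>(\<U> i) \<and>
      (\<forall>U\<in>\<U> i. bounded U \<and> diameter U < \<delta>) \<and> (\<Sum>U\<in>\<U> i. diameter U powr s) \<le> c i"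
    by blast
  show ?thesis
  proof (rule finite_cover_leI[where K = "Sigma I \<U>" and U = snd])
    show "finite (Sigma I \<U>)" using assms(1) \<U> by (intro finite_SigmaI) auto
    show "(\<Union>i\<in>I. S i) \<subseteq> (\<Union>k\<in>Sigma I \<U>. snd k)"
    proof
      fix x assume "x \<in> (\<Union>i\<in>I. S i)"
      then obtain i where i: "i \<in> I" "x \<in> S i" by blast
      then obtain U where "U \<in> \<U> i" "x \<in> U" using \<U>[OF i(1)] by blast
      then show "x \<in> (\<Union>k\<in>Sigma I \<U>. snd k)" using i(1) by force
    qed
    show "bounded (snd k) \<and> diameter (snd k) < \<delta>" if "k \<in> Sigma I \<U>" for k
      using that \<U> by auto
    have "(\<Sum>k\<in>Sigma I \<U>. diameter (snd k) powr s) = (\<Sum>i\<in>I. \<Sum>U\<in>\<U> i. diameter U powr s)"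
      using assms(1) \<U> by (subst sum.Sigma) (auto simp: case_prod_beta)
    also have "\<dots> \<le> (\<Sum>i\<in>I. c i)" using \<U> by (intro sum_mono) auto
    finally show "(\<Sum>k\<in>Sigma I \<U>. diameter (snd k) powr s) \<le> (\<Sum>i\<in>I. c i)" .
  qed
qed

section \<open>Words and cylinders\<close>

lemma word_matrix_Nil [simp]: "word_matrix A [] = mat 1"
  by (simp add: word_matrix_def)

lemma word_matrix_Cons: "word_matrix A (i # w) = A i ** word_matrix A w"
  by (simp add: word_matrix_def)

lemma word_matrix_append: "word_matrix A (u @ v) = word_matrix A u ** word_matrix A v"
  by (induction u) (simp_all add: word_matrix_Cons matrix_mul_assoc)

text \<open>Facts about all words thus pass between \<open>word_transposes\<close> and
  \<open>word_matrix\<close>, and a prefix of a word defining a Furstenberg direction becomes a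
  suffix for the maps.\<close>

lemma word_transposes_eq: "word_transposes A w = transpose (word_matrix A (rev w))"
  unfolding word_transposes_def
  by (induction w) (simp_all add: word_matrix_Cons word_matrix_append matrix_transpose_mul transpose_mat)

lemma word_transposes_append:
  "word_transposes A (u @ v) = word_transposes A u ** word_transposes A v"
  by (simp add: word_transposes_def word_matrix_append)

lemma det_word_matrix: "(\<And>i. det (A i) \<noteq> 0) \<Longrightarrow> det (word_matrix A w) \<noteq> 0"
  by (induction w) (simp_all add: word_matrix_Cons det_mul)

lemma word_map_append: "word_map A t (u @ v) = word_map A t u \<circ> word_map A t v"
  by (induction u) (simp_all add: word_map_def comp_assoc)

lemma word_map_Nil [simp]: "word_map A t [] = id"
  by (simp add: word_map_def)

lemma word_map_Cons: "word_map A t (i # w) x = affine_map A t i (word_map A t w x)"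
  by (simp add: word_map_def)

lemma word_map_diff: "word_map A t w x - word_map A t w y = word_matrix A w *v (x - y)"
  by (induction w) (simp_all add: word_map_Cons affine_map_def word_matrix_Cons
      matrix_vector_mul_assoc[symmetric] matrix_vector_mult_diff_distrib[symmetric])

lemma continuous_on_word_map: "continuous_on S (word_map A t w)"
proof -
  have eq: "word_map A t w = (\<lambda>x. word_matrix A w *v x + word_map A t w 0)"
  proof
    fix x
    show "word_map A t w x = word_matrix A w *v x + word_map A t w 0"
      using word_map_diff[of A t w x 0] by (simp add: diff_eq_eq)
  qed
  show ?thesis
    by (subst eq) (intro continuous_on_add continuous_on_const matrix_vector_mult_linear_continuous_on)
qed

lemma finite_words: "finite {w :: 'i::finite list. length w = n}"
  using finite_lists_length_eq[of "UNIV :: 'i set" n] by simp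

lemma length_prefix_word [simp]: "length (prefix_word x n) = n"
  by (simp add: prefix_word_def)

lemma prefix_word_Suc: "prefix_word x (Suc n) = prefix_word x n @ [x n]"
  by (simp add: prefix_word_def)

lemma cylinder_Nil [simp]: "cylinder [] = UNIV"
  by (simp add: cylinder_def prefix_word_def)

lemma mem_cylinder_iff: "x \<in> cylinder w \<longleftrightarrow> (\<forall>k<length w. x k = w ! k)"
  using list_eq_iff_nth_eq[of "prefix_word x (length w)" w]
  by (simp add: cylinder_def prefix_word_def)

lemma cylinder_append_subset: "cylinder (u @ v) \<subseteq> cylinder u"
  by (auto simp: mem_cylinder_iff nth_append)

lemma cylinder_eq_UN: "cylinder u = (\<Union>v\<in>{v. length v = n}. cylinder (u @ v))"
proof
  show "cylinder u \<subseteq> (\<Union>v\<in>{v. length v = n}. cylinder (u @ v))"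
  proof
    fix x assume x: "x \<in> cylinder u"
    define v where "v = map (\<lambda>k. x (length u + k)) [0..<n]"
    have "x \<in> cylinder (u @ v)" using x by (auto simp: mem_cylinder_iff nth_append v_def)
    then show "x \<in> (\<Union>v\<in>{v. length v = n}. cylinder (u @ v))" by (intro UN_I[of v]) (simp add: v_def)
  qed
qed (use cylinder_append_subset in blast)

lemma disjoint_cylinders:
  "length u = length v \<Longrightarrow> u \<noteq> v \<Longrightarrow> cylinder u \<inter> cylinder v = {}"
  by (auto simp: cylinder_def)

lemma cylinder_in_symbolic_borel: "cylinder w \<in> sets symbolic_borel"
proof -
  have "cylinder w = (\<Pi>\<^sub>E k\<in>UNIV. if k < length w then {w ! k} else UNIV)"
    by (auto simp: mem_cylinder_iff PiE_iff extensional_def split: if_splits)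
  moreover have "openin symbolic_topology (\<Pi>\<^sub>E k\<in>UNIV. if k < length w then {w ! k} else UNIV)"
    unfolding symbolic_topology_def
  proof (rule product_topology_basis)
    show "finite {i. (if i < length w then {w ! i} else UNIV) \<noteq> topspace (discrete_topology UNIV)}"
      by (rule finite_subset[of _ "{..<length w}"]) auto
  qed auto
  ultimately show ?thesis unfolding symbolic_borel_def by auto
qed

section \<open>The attractor, its pieces and the natural projection\<close>

locale planar_ifs =
  fixes A :: "'i::finite \<Rightarrow> real^2^2" and t :: "'i \<Rightarrow> real^2" and X :: "(real^2) set"
  assumes contractive: "opnorm (A i) < 1"
    and det_nonzero: "det (A i) \<noteq> 0"
    and attractor: "is_attractor A t X"
begin

abbreviation "M \<equiv> word_matrix A"
abbreviation "f \<equiv> word_map A t"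

lemma det_M: "det (M w) \<noteq> 0"
  using det_word_matrix det_nonzero by blast

lemma opnorm_M_pos: "0 < opnorm (M w)"
  by (rule opnorm_pos[OF det_M])

lemma compact_X: "compact X" and X_nonempty: "X \<noteq> {}"
  and X_eq: "X = (\<Union>i. affine_map A t i ` X)"
  using attractor unfolding is_attractor_def by auto

lemma X_eq_words: "X = (\<Union>v\<in>{v. length v = n}. f v ` X)"
proof (induction n)
  case (Suc n)
  have words: "{v :: 'i list. length v = Suc n} = (\<Union>i. (#) i ` {v. length v = n})"
    by (auto simp: length_Suc_conv)
  have "(\<Union>v\<in>{v. length v = Suc n}. f v ` X)
      = (\<Union>i. affine_map A t i ` (\<Union>v\<in>{v. length v = n}. f v ` X))"
    unfolding words image_UN UN_UN_flatten by (auto simp: word_map_Cons image_image)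
  then show ?case unfolding Suc[symmetric] X_eq[symmetric] by simp
qed simp

lemma f_append_image: "f (u @ v) ` X = f u ` (f v ` X)"
  by (simp add: word_map_append image_comp)

lemma f_image_subset: "f w ` X \<subseteq> X"
  using X_eq_words[of "length w"] by blast

lemma f_append_image_subset: "f (u @ v) ` X \<subseteq> f u ` X"
  unfolding f_append_image using f_image_subset by blast

lemma f_image_eq_words: "f u ` X = (\<Union>v\<in>{v. length v = n}. f (u @ v) ` X)"
  by (subst X_eq_words[of n]) (simp add: f_append_image image_UN)

lemma compact_f_image: "compact (f w ` X)"
  using compact_X continuous_on_word_map by (rule compact_continuous_image[rotated])

lemma diameter_bound: obtains R where "0 < R" "\<And>x y. x \<in> X \<Longrightarrow> y \<in> X \<Longrightarrow> norm (x - y) \<le> R"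
proof -
  have "bounded X" using compact_X by (rule compact_imp_bounded)
  then obtain b where b: "\<And>x. x \<in> X \<Longrightarrow> norm x \<le> b" unfolding bounded_iff by blast
  have "norm (x - y) \<le> 2 * \<bar>b\<bar> + 1" if "x \<in> X" "y \<in> X" for x y
    using norm_triangle_ineq4[of x y] b[OF that(1)] b[OF that(2)] by linarith
  then show ?thesis by (rule that[rotated]) auto
qed

lemma opnorm_word_decay: obtains k where "0 < k" "k < 1" "\<And>w. opnorm (M w) \<le> k ^ length w"
proof -
  define k where "k = Max (range (\<lambda>i. opnorm (A i)))"
  have k: "opnorm (A i) \<le> k" for i unfolding k_def by (rule Max_ge) auto
  have "k \<in> range (\<lambda>i. opnorm (A i))" unfolding k_def by (rule Max_in) auto
  then have "k < 1" "0 < k" using contractive opnorm_pos[OF det_nonzero] by auto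
  moreover have "opnorm (M w) \<le> k ^ length w" for w
  proof (induction w)
    case (Cons i w)
    have "opnorm (M (i # w)) \<le> opnorm (A i) * opnorm (M w)"
      unfolding word_matrix_Cons by (rule opnorm_mult)
    also have "\<dots> \<le> k * k ^ length w"
      using k Cons opnorm_nonneg \<open>0 < k\<close> by (intro mult_mono) auto
    finally show ?case by simp
  qed (simp add: opnorm_mat_1[simplified])
  ultimately show ?thesis using that by blast
qed

lemma opnorm_word_small:
  assumes "0 < \<epsilon>" obtains n where "\<And>w. n \<le> length w \<Longrightarrow> opnorm (M w) < \<epsilon>"
proof -
  obtain k where k: "0 < k" "k < 1" "\<And>w. opnorm (M w) \<le> k ^ length w" using opnorm_word_decay by blast
  obtain n where n: "k ^ n < \<epsilon>" using real_arch_pow_inv[OF assms k(2)] by blast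
  have "opnorm (M w) < \<epsilon>" if "n \<le> length w" for w
    using k(3)[of w] power_decreasing[OF that, of k] k(1,2) n by linarith
  then show ?thesis by (rule that)
qed

text \<open>The defining limit starts at 0, which may lie outside \<open>X\<close>. Started at
  \<open>p\<close> in \<open>X\<close> instead, the iterates stay in nested compact pieces and form
  a Cauchy sequence, and contraction gives both orbits the same limit.\<close>

lemma natural_projection_mem: "natural_projection A t x \<in> f (prefix_word x n) ` X"
proof -
  define F where "F n = f (prefix_word x n)" for n
  obtain p where p: "p \<in> X" using X_nonempty by blast
  obtain R where R: "0 < R" "\<And>x y. x \<in> X \<Longrightarrow> y \<in> X \<Longrightarrow> norm (x - y) \<le> R" using diameter_bound by blast
  have decr: "F m ` X \<subseteq> F n ` X" if "n \<le> m" for n m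
    using that
  proof (induction m rule: dec_induct)
    case (step m)
    have "F (Suc m) ` X \<subseteq> F m ` X" unfolding F_def prefix_word_Suc by (rule f_append_image_subset)
    then show ?case using step by blast
  qed simp
  have "Cauchy (\<lambda>n. F n p)"
  proof (rule CauchyI)
    fix e :: real assume "0 < e"
    then obtain N where N: "\<And>w. N \<le> length w \<Longrightarrow> opnorm (M w) < e / (R + 1)"
      using opnorm_word_small[of "e / (R + 1)"] R(1) by auto
    have "norm (F m p - F n p) < e" if mn: "N \<le> m" "N \<le> n" for m n
    proof -
      obtain a b where ab: "a \<in> X" "b \<in> X" "F m p = F N a" "F n p = F N b"
        using decr[OF mn(1)] decr[OF mn(2)] p by blast
      have "norm (F m p - F n p) \<le> opnorm (M (prefix_word x N)) * norm (a - b)"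
        unfolding ab unfolding F_def word_map_diff by (rule norm_mult_vec_le)
      also have "\<dots> \<le> e / (R + 1) * R"
        using N[of "prefix_word x N"] R ab \<open>0 < e\<close> by (intro mult_mono) (auto simp: opnorm_nonneg)
      also have "\<dots> < e" using R(1) \<open>0 < e\<close> by (simp add: field_simps)
      finally show ?thesis .
    qed
    then show "\<exists>N. \<forall>m\<ge>N. \<forall>n\<ge>N. norm (F m p - F n p) < e" by blast
  qed
  then obtain z where z: "(\<lambda>n. F n p) \<longlonglongrightarrow> z" by (auto simp: Cauchy_convergent_iff convergent_def)
  have "(\<lambda>n. F n 0 - F n p) \<longlonglongrightarrow> 0"
  proof (rule LIMSEQ_I)
    fix e :: real assume "0 < e"
    then obtain N where N: "\<And>w. N \<le> length w \<Longrightarrow> opnorm (M w) < e / (norm p + 1)"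
      using opnorm_word_small[of "e / (norm p + 1)"] by (auto simp: add_nonneg_pos)
    have "norm (F n 0 - F n p) < e" if "N \<le> n" for n
    proof -
      have "norm (F n 0 - F n p) \<le> opnorm (M (prefix_word x n)) * norm (0 - p)"
        unfolding F_def word_map_diff by (rule norm_mult_vec_le)
      also have "\<dots> \<le> e / (norm p + 1) * norm p"
        using N[of "prefix_word x n"] that \<open>0 < e\<close> by (intro mult_mono) (auto simp: opnorm_nonneg less_imp_le)
      also have "\<dots> < e" using \<open>0 < e\<close> by (simp add: divide_less_eq mult_strict_left_mono add_nonneg_pos)
      finally show ?thesis .
    qed
    then show "\<exists>N. \<forall>n\<ge>N. norm (F n 0 - F n p - 0) < e" by auto
  qed
  from tendsto_add[OF this z] have "(\<lambda>n. F n 0) \<longlonglongrightarrow> z" by simp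
  then have "natural_projection A t x = z" unfolding natural_projection_def F_def by (rule limI)
  moreover have "z \<in> F n ` X"
  proof (rule closed_sequentially)
    show "closed (F n ` X)" unfolding F_def by (rule compact_imp_closed[OF compact_f_image])
    show "(\<lambda>m. F (m + n) p) \<longlonglongrightarrow> z" using z by (rule LIMSEQ_ignore_initial_segment)
    show "F (m + n) p \<in> F n ` X" for m using decr[of n "m + n"] p by auto
  qed
  ultimately show ?thesis unfolding F_def by simp
qed

end

section \<open>Expansion on the multicone\<close>

lemma vector_2_eq_axis: "(vector [a, b] :: real^2) = a *\<^sub>R axis 1 1 + b *\<^sub>R axis 2 1"
  by (simp add: vec_eq_iff forall_2 axis_def)

lemma span_singleton_in_RP1: "v \<noteq> 0 \<Longrightarrow> span {v} \<in> RP1" for v :: "real^2"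
  by (simp add: RP1_def)

lemma RP1_eq_span:
  assumes "V \<in> RP1" "v \<in> V" "v \<noteq> 0" shows "V = span {v}"
proof -
  have "span {v} \<subseteq> V" using assms by (simp add: RP1_def span_minimal)
  moreover have "dim V \<le> dim (span {v})" using assms by (simp add: RP1_def)
  ultimately show ?thesis using assms subspace_dim_equal[of "span {v}" V]
    by (simp add: RP1_def)
qed

lemma RP1_obtain_unit:
  assumes "V \<in> RP1" obtains e where "norm e = 1" "V = span {e}"
proof -
  have "V \<noteq> {0}" using assms by (auto simp: RP1_def)
  then obtain v where v: "v \<in> V" "v \<noteq> 0" using assms subspace_0 by (auto simp: RP1_def)
  have "norm (v /\<^sub>R norm v) = 1" using v by simp
  moreover have "v /\<^sub>R norm v \<in> V" using v assms by (simp add: RP1_def subspace_scale)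
  ultimately show ?thesis
    using RP1_eq_span[OF assms, of "v /\<^sub>R norm v"] v(2) by (intro that[of "v /\<^sub>R norm v"]) auto
qed

lemma span_scaleR: "c \<noteq> 0 \<Longrightarrow> span {c *\<^sub>R v} = span {v}" for v :: "real^2"
  using span_image_scale[of "{v}" "\<lambda>_. c"] by simp

lemma span_eq_if_cross2_eq_0:
  assumes "cross2 x y = 0" "x \<noteq> 0" "y \<noteq> 0" shows "span {x} = span {y}"
proof -
  obtain c where "x = c *\<^sub>R y" using cross2_eq_0_span assms by blast
  then show ?thesis using span_scaleR[of c y] assms(2) by auto
qed

lemma projective_action_span: "projective_action M (span {v}) = span {M *v v}"
  unfolding projective_action_def
  using linear_span_image[of "(*v) M" "{v}"] by simp

text \<open>The adjugate, as a linear map: it avoids inverting \<open>M\<close> and has the same norm as \<open>M\<close>.\<close>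

definition adjugate2 :: "real^2^2 \<Rightarrow> real^2 \<Rightarrow> real^2" where
  "adjugate2 M x = vector [M$2$2 * x$1 - M$1$2 * x$2, M$1$1 * x$2 - M$2$1 * x$1]"

lemma mult_adjugate2: "M *v adjugate2 M x = det M *\<^sub>R x"
  by (simp add: vec_eq_iff forall_2 mult_vec_2 adjugate2_def det_2 algebra_simps)

lemma adjugate2_mult: "adjugate2 M (M *v x) = det M *\<^sub>R x"
  by (simp add: vec_eq_iff forall_2 mult_vec_2 adjugate2_def det_2 algebra_simps)

lemma linear_adjugate2: "linear (adjugate2 M)"
  by (rule linearI) (simp_all add: vec_eq_iff forall_2 adjugate2_def algebra_simps)

lemma norm_vector_2: "norm (vector [a, b] :: real^2) = sqrt (a\<^sup>2 + b\<^sup>2)"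
  by (simp add: norm_eq_sqrt_inner inner_2 power2_eq_square)

text \<open>The adjugate is the transpose conjugated with a quarter turn.\<close>

lemma norm_adjugate2_eq:
  "norm (adjugate2 M x) = norm (transpose M *v vector [- x$2, x$1])"
proof -
  have "(norm (adjugate2 M x))\<^sup>2 = (norm (transpose M *v vector [- x$2, x$1]))\<^sup>2"
    unfolding norm_2_sq
    by (simp add: mult_vec_2 adjugate2_def transpose_def power2_eq_square algebra_simps)
  then show ?thesis by (simp add: power2_eq_iff_nonneg)
qed

lemma norm_adjugate2_le: "norm (adjugate2 M x) \<le> opnorm M * norm x"
proof -
  have "norm (vector [- x$2, x$1] :: real^2) = norm x"
    by (simp add: norm_vector_2 norm_eq_sqrt_inner inner_2 power2_eq_square add.commute)
  then show ?thesis unfolding norm_adjugate2_eq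
    using norm_mult_vec_le[of "transpose M" "vector [- x$2, x$1]"]
    by (simp add: opnorm_transpose del: transpose_matrix_vector)
qed

lemma opnorm_le_adjugate2:
  assumes "\<And>x. norm (adjugate2 M x) \<le> b * norm x" shows "opnorm M \<le> b"
proof -
  have "norm (transpose M *v x) \<le> b * norm x" for x
  proof -
    define z :: "real^2" where "z = vector [x$2, - x$1]"
    have "x = vector [- z$2, z$1]" unfolding z_def by (simp add: vec_eq_iff forall_2)
    moreover have "norm z = norm x"
      unfolding z_def by (simp add: norm_vector_2 norm_eq_sqrt_inner inner_2 power2_eq_square add.commute)
    ultimately show ?thesis using assms[of z] norm_adjugate2_eq[of M z] by simp
  qed
  then have "opnorm (transpose M) \<le> b" by (rule opnorm_le)
  then show ?thesis unfolding opnorm_transpose .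
qed

text \<open>\<open>\<bar>det M\<bar> / opnorm M\<close> is the smaller singular value; the bound
  comes from applying the adjugate to \<open>M *v x\<close>.\<close>

lemma det_mult_norm_le: "\<bar>det M\<bar> * norm x \<le> opnorm M * norm (M *v x)"
  using norm_adjugate2_le[of M "M *v x"] by (simp add: adjugate2_mult)

lemma det_le_opnorm_sq: "\<bar>det N\<bar> \<le> (opnorm N)\<^sup>2"
proof -
  define x :: "real^2" where "x = axis 1 1"
  have x: "norm x = 1" by (simp add: x_def)
  have "\<bar>det N\<bar> * norm x \<le> opnorm N * norm (N *v x)" by (rule det_mult_norm_le)
  also have "\<dots> \<le> opnorm N * (opnorm N * norm x)"
    by (intro mult_left_mono norm_mult_vec_le opnorm_nonneg)
  finally show ?thesis by (simp add: x power2_eq_square)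
qed

text \<open>Cramer's rule: a linear map is controlled by its values on two independent
  vectors.\<close>

lemma norm_linear_le_basis:
  assumes "linear g" "cross2 e\<^sub>1 e\<^sub>2 \<noteq> 0"
  shows "norm (g x) \<le> (norm e\<^sub>1 + norm e\<^sub>2) / \<bar>cross2 e\<^sub>1 e\<^sub>2\<bar> * (norm (g e\<^sub>1) + norm (g e\<^sub>2)) * norm x"
proof -
  interpret linear g by fact
  have "cross2 e\<^sub>1 e\<^sub>2 *\<^sub>R x = cross2 x e\<^sub>2 *\<^sub>R e\<^sub>1 + cross2 e\<^sub>1 x *\<^sub>R e\<^sub>2"
    by (simp add: vec_eq_iff forall_2 cross2_def algebra_simps)
  then have "cross2 e\<^sub>1 e\<^sub>2 *\<^sub>R g x = cross2 x e\<^sub>2 *\<^sub>R g e\<^sub>1 + cross2 e\<^sub>1 x *\<^sub>R g e\<^sub>2"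
    by (metis add scaleR)
  then have "\<bar>cross2 e\<^sub>1 e\<^sub>2\<bar> * norm (g x) = norm (cross2 x e\<^sub>2 *\<^sub>R g e\<^sub>1 + cross2 e\<^sub>1 x *\<^sub>R g e\<^sub>2)"
    by (metis norm_scaleR)
  also have "\<dots> \<le> \<bar>cross2 x e\<^sub>2\<bar> * norm (g e\<^sub>1) + \<bar>cross2 e\<^sub>1 x\<bar> * norm (g e\<^sub>2)"
    by (rule order_trans[OF norm_triangle_ineq]) simp
  also have "\<dots> \<le> (norm x * norm e\<^sub>2) * norm (g e\<^sub>1) + (norm e\<^sub>1 * norm x) * norm (g e\<^sub>2)"
    by (intro add_mono mult_right_mono abs_cross2_le) auto
  also have "\<dots> \<le> (norm e\<^sub>1 + norm e\<^sub>2) * (norm (g e\<^sub>1) + norm (g e\<^sub>2)) * norm x"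
    by (simp add: algebra_simps)
  finally show ?thesis using assms(2) by (simp add: field_simps)
qed

lemma word_transposes_Nil [simp]: "word_transposes A [] = mat 1"
  by (simp add: word_transposes_def)

lemma word_transposes_snoc: "word_transposes A (w @ [i]) = word_transposes A w ** transpose (A i)"
  by (simp add: word_transposes_append) (simp add: word_transposes_def word_matrix_Cons)

lemma word_transposes_Cons: "word_transposes A (i # w) = transpose (A i) ** word_transposes A w"
  by (simp add: word_transposes_def word_matrix_Cons)

text \<open>Vectors replace lines: by \<open>openin_RP1_topology\<close> openness in the quotient is
  openness in the plane, and compactness can be tested on unit vectors.\<close>

definition line_cone :: "(real^2) set set \<Rightarrow> (real^2) set" where
  "line_cone \<C> = {v. v \<noteq> 0 \<and> span {v} \<in> \<C>}"

lemma line_cone_scaleR: "v \<in> line_cone \<C> \<Longrightarrow> c \<noteq> 0 \<Longrightarrow> c *\<^sub>R v \<in> line_cone \<C>"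
  by (simp add: line_cone_def span_scaleR)

text \<open>On the unit circle an interval of lines is a compact arc together with its antipodal
  arc.\<close>

lemma compact_line_cone_sphere:
  assumes "finite \<I>" "\<And>I. I \<in> \<I> \<Longrightarrow> closed_projective_interval I" "\<C> = \<Union>\<I>"
  shows "compact (line_cone \<C> \<inter> sphere 0 1)"
proof -
  define cis2 :: "real \<Rightarrow> real^2" where "cis2 \<theta> = vector [cos \<theta>, sin \<theta>]" for \<theta>
  have ncis: "norm (cis2 \<theta>) = 1" for \<theta> unfolding cis2_def by (simp add: norm_vector_2)
  have "compact (line_cone I \<inter> sphere 0 1)" if "I \<in> \<I>" for I
  proof -
    obtain a b where I: "I = line_at ` {a..b}"
      using assms(2)[OF \<open>I \<in> \<I>\<close>] unfolding closed_projective_interval_def by blast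
    have "line_cone I \<inter> sphere 0 1 = cis2 ` {a..b} \<union> (\<lambda>\<theta>. - cis2 \<theta>) ` {a..b}"
    proof
      show "line_cone I \<inter> sphere 0 1 \<subseteq> cis2 ` {a..b} \<union> (\<lambda>\<theta>. - cis2 \<theta>) ` {a..b}"
      proof
        fix v assume v: "v \<in> line_cone I \<inter> sphere 0 1"
        then obtain \<theta> where \<theta>: "\<theta> \<in> {a..b}" "span {v} = span {cis2 \<theta>}"
          unfolding line_cone_def I line_at_def cis2_def by auto
        have "v \<in> span {cis2 \<theta>}" using \<theta>(2) span_base[of v "{v}"] by simp
        then obtain c where c: "v = c *\<^sub>R cis2 \<theta>" by (auto simp: span_singleton)
        then have "\<bar>c\<bar> = 1" using v ncis by simp
        then have "c = 1 \<or> c = -1" by linarith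
        then show "v \<in> cis2 ` {a..b} \<union> (\<lambda>\<theta>. - cis2 \<theta>) ` {a..b}" using c \<theta>(1) by auto
      qed
      have "cis2 \<theta> \<in> line_cone I \<inter> sphere 0 1" if "\<theta> \<in> {a..b}" for \<theta>
        using that ncis[of \<theta>] unfolding line_cone_def I line_at_def cis2_def[symmetric] by auto
      moreover have "- cis2 \<theta> \<in> line_cone I \<inter> sphere 0 1" if "\<theta> \<in> {a..b}" for \<theta>
        using line_cone_scaleR[of "cis2 \<theta>" I "-1"] calculation[OF that] by simp
      ultimately show "cis2 ` {a..b} \<union> (\<lambda>\<theta>. - cis2 \<theta>) ` {a..b} \<subseteq> line_cone I \<inter> sphere 0 1"
        by blast
    qed
    moreover have "continuous_on {a..b} cis2"
      unfolding cis2_def vector_2_eq_axis by (intro continuous_intros)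
    ultimately show ?thesis
      by (metis compact_Icc compact_Un compact_continuous_image continuous_on_minus)
  qed
  moreover have "line_cone \<C> \<inter> sphere 0 1 = (\<Union>I\<in>\<I>. line_cone I \<inter> sphere 0 1)"
    unfolding assms(3) line_cone_def by auto
  ultimately show ?thesis using assms(1) compact_UN by metis
qed

lemma line_cone_invariant:
  assumes "strongly_invariant_multicone A \<C>" "\<And>i. det (A i) \<noteq> 0" "y \<in> line_cone \<C>"
  shows "word_transposes A w *v y \<in> line_cone \<C>"
proof (induction w)
  case (Cons i w)
  define x where "x = word_transposes A w *v y"
  have x: "x \<noteq> 0" "span {x} \<in> \<C>" using Cons by (simp_all add: x_def line_cone_def)
  have "projective_action (transpose (A i)) (span {x}) \<in> RP1_topology interior_of \<C>"
    using assms(1) x(2) unfolding strongly_invariant_multicone_def by blast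
  then have "span {transpose (A i) *v x} \<in> \<C>"
    unfolding projective_action_span using interior_of_subset[of RP1_topology \<C>] by blast
  moreover have "transpose (A i) *v x \<noteq> 0"
    using det_eq_0_iff_kernel[of "transpose (A i)"] x(1) assms(2) by auto
  ultimately show ?case unfolding word_transposes_Cons matrix_vector_mul_assoc[symmetric] x_def[symmetric]
    by (simp add: line_cone_def)
qed (simp add: assms(3))

text \<open>Fix two independent directions outside of the cone. The image \<open>x\<close> of each of them under the
  adjugate of a word matrix \<open>T\<close> stays outside of the cone, so it makes a definite angle with any
  \<open>v\<close> well inside the cone, whereas \<open>cross2 v x\<close> is bounded by the norm of \<open>T v\<close>. So if \<open>T v\<close> is
  short then both images are short, hence so is the adjugate, which has the same norm as \<open>T\<close>.\<close>

lemma multicone_expansion: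
  fixes A :: "'i::finite \<Rightarrow> real^2^2"
  assumes cone: "strongly_invariant_multicone A \<C>" and det: "\<And>i. det (A i) \<noteq> 0"
  obtains \<kappa> where "0 < \<kappa>"
    "\<And>w y. y \<in> line_cone \<C> \<Longrightarrow>
        \<kappa> * opnorm (word_transposes A w) * norm y \<le> norm (word_transposes A w *v y)"
proof -
  define D where "D = line_cone \<C>"
  define Q where "Q = line_cone (RP1_topology interior_of \<C>)"
  obtain \<I> where \<I>: "finite \<I>" "\<And>I. I \<in> \<I> \<Longrightarrow> closed_projective_interval I" "\<C> = \<Union>\<I>"
    using cone unfolding strongly_invariant_multicone_def by blast
  have \<C>: "\<C> \<noteq> {}" "\<C> \<subseteq> RP1" "\<C> \<noteq> RP1"
    using cone unfolding strongly_invariant_multicone_def by blast+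
  have "open Q"
    unfolding Q_def line_cone_def
    using openin_interior_of[of RP1_topology \<C>] unfolding openin_RP1_topology by simp
  have "Q \<subseteq> D" unfolding Q_def D_def line_cone_def using interior_of_subset[of RP1_topology \<C>] by auto
  define B where "B i = transpose (A i)" for i
  have B_nz: "B i *v x \<noteq> 0" if "x \<noteq> 0" for i x
    using det_eq_0_iff_kernel[of "B i"] that det by (auto simp: B_def)
  have BO: "B i *v y \<in> Q" if "y \<in> D" for i y
  proof -
    have "projective_action (B i) (span {y}) \<in> RP1_topology interior_of \<C>"
      using cone that unfolding strongly_invariant_multicone_def B_def D_def line_cone_def by blast
    then show ?thesis using that B_nz unfolding Q_def D_def line_cone_def projective_action_span by simp
  qed
  define K where "K = D \<inter> sphere 0 1"
  have K: "compact K" unfolding K_def D_def by (rule compact_line_cone_sphere[OF \<I>])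
  have unit_K: "y /\<^sub>R norm y \<in> K" if "y \<in> D" for y
    using that line_cone_scaleR[of y \<C> "inverse (norm y)"] unfolding K_def D_def
    by (auto simp: line_cone_def)
  \<comment> \<open>The nonzero vectors outside of the cone form an open set because
    \<open>K\<close> is compact; this leaves room for a second, independent direction
    \<open>e\<^sub>2\<close> next to \<open>e\<^sub>1\<close>.\<close>
  define W where "W = {v. v \<noteq> 0 \<and> v /\<^sub>R norm v \<notin> K}"
  have WD: "v \<notin> D" if "v \<in> W" for v using that unit_K unfolding W_def by blast
  have "open (- {0} \<inter> (\<lambda>v::real^2. v /\<^sub>R norm v) -` (- K))"
    by (intro continuous_open_preimage continuous_intros)
      (use compact_imp_closed[OF K] in auto)
  moreover have "W = - {0} \<inter> (\<lambda>v::real^2. v /\<^sub>R norm v) -` (- K)" unfolding W_def by auto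
  ultimately have "open W" by simp
  obtain V\<^sub>0 where "V\<^sub>0 \<in> RP1" "V\<^sub>0 \<notin> \<C>" using \<C> by blast
  then obtain e\<^sub>1 where e1: "norm e\<^sub>1 = 1" "V\<^sub>0 = span {e\<^sub>1}" using RP1_obtain_unit by metis
  have e1D: "e\<^sub>1 \<notin> D" using e1 \<open>V\<^sub>0 \<notin> \<C>\<close> by (simp add: D_def line_cone_def)
  then have "e\<^sub>1 \<in> W" using e1 by (auto simp: W_def K_def)
  then obtain \<epsilon> where \<epsilon>: "0 < \<epsilon>" "ball e\<^sub>1 \<epsilon> \<subseteq> W" using \<open>open W\<close> open_contains_ball by blast
  define J :: "real^2" where "J = vector [- e\<^sub>1$2, e\<^sub>1$1]"
  have nJ: "norm J = 1"
    unfolding J_def norm_vector_2 using norm_2_sq[of e\<^sub>1] e1(1) by (simp add: add.commute)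
  define e\<^sub>2 where "e\<^sub>2 = e\<^sub>1 + (\<epsilon> / 2) *\<^sub>R J"
  have "e\<^sub>2 \<in> W" using \<epsilon> nJ unfolding e\<^sub>2_def by (intro subsetD[OF \<epsilon>(2)]) (simp add: dist_norm)
  then have e2D: "e\<^sub>2 \<notin> D" using WD by blast
  have "cross2 e\<^sub>1 e\<^sub>2 = \<epsilon> / 2 * (norm e\<^sub>1)\<^sup>2"
    unfolding norm_2_sq by (simp add: cross2_def e\<^sub>2_def J_def power2_eq_square algebra_simps)
  then have cr: "cross2 e\<^sub>1 e\<^sub>2 \<noteq> 0" using \<epsilon> e1 by simp
  \<comment> \<open>A cone vector moved by one letter has its direction in the compact set
    \<open>P\<close>, inside the open cone \<open>Q\<close>; the unit vectors outside of
    \<open>Q\<close> form the compact set \<open>U\<close>. The area between the two attains its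
    minimum, which is positive because a line cannot lie both in \<open>Q\<close> and
    outside.\<close>
  define P where "P = (\<Union>i. (\<lambda>y. (B i *v y) /\<^sub>R norm (B i *v y)) ` K)"
  define U where "U = sphere 0 1 - Q"
  have "compact P" unfolding P_def
  proof (intro compact_UN compact_continuous_image K)
    fix i
    have "0 \<notin> K" by (auto simp: K_def)
    then have "B i *v y \<noteq> 0" if "y \<in> K" for y using B_nz that by metis
    then show "continuous_on K (\<lambda>y. (B i *v y) /\<^sub>R norm (B i *v y))"
      by (intro continuous_intros matrix_vector_mult_linear_continuous_on) auto
  qed auto
  moreover have "compact U" unfolding U_def by (intro compact_diff compact_sphere \<open>open Q\<close>)
  ultimately have cPU: "compact (P \<times> U)" by (rule compact_Times)
  have PU: "P \<times> U \<noteq> {}"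
  proof -
    obtain V where "V \<in> \<C>" using \<C>(1) by blast
    then obtain e where "norm e = 1" "V = span {e}" using \<C>(2) RP1_obtain_unit by blast
    then have "e \<in> K" using \<open>V \<in> \<C>\<close> by (auto simp: K_def D_def line_cone_def)
    moreover have "e\<^sub>1 \<in> U" using e1 e1D \<open>Q \<subseteq> D\<close> by (auto simp: U_def)
    ultimately show ?thesis unfolding P_def by blast
  qed
  have "continuous_on (P \<times> U) (\<lambda>z. \<bar>cross2 (fst z) (snd z)\<bar>)"
    unfolding cross2_def by (intro continuous_intros)
  from continuous_attains_inf[OF cPU PU this] obtain z where z: "z \<in> P \<times> U"
      and zmin: "\<And>z'. z' \<in> P \<times> U \<Longrightarrow> \<bar>cross2 (fst z) (snd z)\<bar> \<le> \<bar>cross2 (fst z') (snd z')\<bar>"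
    by blast
  define \<delta> where "\<delta> = \<bar>cross2 (fst z) (snd z)\<bar>"
  have PO: "p \<in> Q" if p: "p \<in> P" for p
  proof -
    obtain i y where y: "y \<in> K" "p = (B i *v y) /\<^sub>R norm (B i *v y)" using p unfolding P_def by blast
    then have "B i *v y \<in> Q" using BO by (auto simp: K_def)
    then show ?thesis unfolding y(2) Q_def by (intro line_cone_scaleR) (auto simp: line_cone_def)
  qed
  have "\<delta> \<noteq> 0"
  proof
    assume "\<delta> = 0"
    moreover have "fst z \<noteq> 0" "snd z \<noteq> 0" using z PO by (auto simp: Q_def line_cone_def U_def)
    ultimately have "span {fst z} = span {snd z}" unfolding \<delta>_def by (intro span_eq_if_cross2_eq_0) auto
    moreover have "fst z \<in> Q" using z PO by auto
    ultimately have "snd z \<in> Q" using \<open>snd z \<noteq> 0\<close> by (simp add: Q_def line_cone_def)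
    then show False using z by (auto simp: U_def)
  qed
  then have \<delta>: "0 < \<delta>" unfolding \<delta>_def by simp
  have cross_ge: "\<delta> * norm (B i *v y) * norm x \<le> \<bar>cross2 (B i *v y) x\<bar>"
    if "y \<in> D" "x \<noteq> 0" "x \<notin> D" for i y x
  proof -
    define v where "v = B i *v y"
    have y0: "y \<noteq> 0" using that by (auto simp: D_def line_cone_def)
    then have v0: "v \<noteq> 0" unfolding v_def by (rule B_nz)
    define y' where "y' = y /\<^sub>R norm y"
    have "(B i *v y') /\<^sub>R norm (B i *v y') = v /\<^sub>R norm v"
      using y0 unfolding v_def y'_def by (simp add: matrix_vector_mult_scaleR)
    then have "v /\<^sub>R norm v \<in> (\<lambda>y. (B i *v y) /\<^sub>R norm (B i *v y)) ` K"
      using unit_K[OF that(1)] unfolding y'_def[symmetric] by (intro image_eqI[of _ _ y']) simp_all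
    then have "v /\<^sub>R norm v \<in> P" unfolding P_def by blast
    moreover have "x /\<^sub>R norm x \<in> U"
    proof -
      have "x /\<^sub>R norm x \<notin> Q"
      proof
        assume "x /\<^sub>R norm x \<in> Q"
        then have "norm x *\<^sub>R (x /\<^sub>R norm x) \<in> Q"
          unfolding Q_def by (rule line_cone_scaleR) (use that in simp)
        moreover have "norm x *\<^sub>R (x /\<^sub>R norm x) = x" using that by simp
        ultimately show False using that \<open>Q \<subseteq> D\<close> by auto
      qed
      then show ?thesis using that by (simp add: U_def)
    qed
    ultimately have "\<delta> \<le> \<bar>cross2 (v /\<^sub>R norm v) (x /\<^sub>R norm x)\<bar>"
      using zmin[of "(v /\<^sub>R norm v, x /\<^sub>R norm x)"] unfolding \<delta>_def by simp
    also have "cross2 (v /\<^sub>R norm v) (x /\<^sub>R norm x) = cross2 v x / (norm v * norm x)"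
      by (simp add: cross2_def divide_inverse algebra_simps)
    finally show ?thesis using v0 that unfolding v_def[symmetric] by (simp add: abs_divide field_simps abs_mult)
  qed
  have D_inv: "word_transposes A w *v y \<in> D" if "y \<in> D" for w y
    using that unfolding D_def by (rule line_cone_invariant[OF cone det])
  define c where "c = (norm e\<^sub>1 + norm e\<^sub>2) / \<bar>cross2 e\<^sub>1 e\<^sub>2\<bar> * (norm e\<^sub>1 + norm e\<^sub>2)"
  have "0 < norm e\<^sub>1 + norm e\<^sub>2" using e1 by (simp add: add_pos_nonneg)
  then have c: "0 < c" unfolding c_def using cr by simp
  have step: "\<delta> / c * opnorm (word_transposes A w) * norm (B i *v y)
      \<le> norm (word_transposes A w *v (B i *v y))" if "y \<in> D" for w i y
  proof -
    define T where "T = word_transposes A w"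
    define v where "v = B i *v y"
    have v0: "0 < norm v" using B_nz that by (auto simp: v_def D_def line_cone_def)
    have dT: "det T \<noteq> 0" unfolding T_def word_transposes_eq using det_word_matrix[OF det] by simp
    have adj: "norm (adjugate2 T e) \<le> norm (T *v v) * norm e / (\<delta> * norm v)" if e: "e \<notin> D" "e \<noteq> 0" for e
    proof -
      define x where "x = adjugate2 T e"
      have Tx: "T *v x = det T *\<^sub>R e" unfolding x_def by (rule mult_adjugate2)
      have "x \<notin> D"
      proof
        assume "x \<in> D"
        then have "T *v x \<in> D" unfolding T_def by (rule D_inv)
        then have "inverse (det T) *\<^sub>R (det T *\<^sub>R e) \<in> D"
          unfolding Tx D_def by (rule line_cone_scaleR) (use dT in simp)
        moreover have "inverse (det T) *\<^sub>R (det T *\<^sub>R e) = e" using dT by simp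
        ultimately show False using e(1) by simp
      qed
      moreover have "x \<noteq> 0" using Tx dT e(2) by auto
      ultimately have "\<delta> * norm v * norm x \<le> \<bar>cross2 v x\<bar>"
        unfolding v_def using cross_ge \<open>y \<in> D\<close> by blast
      also have "\<bar>cross2 v x\<bar> = \<bar>cross2 (T *v v) e\<bar>"
      proof -
        have "det T * cross2 v x = det T * cross2 (T *v v) e"
          using cross2_mult[of T v x] unfolding Tx by (simp add: cross2_def algebra_simps)
        then show ?thesis using dT by simp
      qed
      also have "\<dots> \<le> norm (T *v v) * norm e" by (rule abs_cross2_le)
      finally show ?thesis unfolding x_def using \<delta> v0 by (simp add: field_simps)
    qed
    have "opnorm T \<le> c * norm (T *v v) / (\<delta> * norm v)"
    proof (rule opnorm_le_adjugate2)
      fix x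
      have "e\<^sub>1 \<noteq> 0" "e\<^sub>2 \<noteq> 0" using cr by (auto simp: cross2_def)
      have "norm (adjugate2 T x)
          \<le> (norm e\<^sub>1 + norm e\<^sub>2) / \<bar>cross2 e\<^sub>1 e\<^sub>2\<bar> * (norm (adjugate2 T e\<^sub>1) + norm (adjugate2 T e\<^sub>2)) * norm x"
        by (rule norm_linear_le_basis[OF linear_adjugate2 cr])
      also have "\<dots> \<le> (norm e\<^sub>1 + norm e\<^sub>2) / \<bar>cross2 e\<^sub>1 e\<^sub>2\<bar>
          * (norm (T *v v) * norm e\<^sub>1 / (\<delta> * norm v) + norm (T *v v) * norm e\<^sub>2 / (\<delta> * norm v)) * norm x"
        by (intro mult_left_mono mult_right_mono add_mono adj e1D e2D \<open>e\<^sub>1 \<noteq> 0\<close> \<open>e\<^sub>2 \<noteq> 0\<close>) auto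
      also have "\<dots> = c * norm (T *v v) / (\<delta> * norm v) * norm x"
        unfolding c_def by (simp add: add_divide_distrib[symmetric] algebra_simps)
      finally show "norm (adjugate2 T x) \<le> c * norm (T *v v) / (\<delta> * norm v) * norm x" .
    qed
    then show ?thesis unfolding T_def[symmetric] v_def[symmetric]
      using c \<delta> v0 by (simp add: field_simps)
  qed
  \<comment> \<open>\<open>step\<close> speaks of vectors already moved by a letter. So the last
    letter of a word, which acts first, is split off, and \<open>a\<close> bounds its distortion
    over the finite alphabet.\<close>
  define a where "a = Min (range (\<lambda>i. \<bar>det (B i)\<bar> / (opnorm (B i))\<^sup>2))"
  have dB: "det (B i) \<noteq> 0" for i by (simp add: B_def det)
  have "a \<in> range (\<lambda>i. \<bar>det (B i)\<bar> / (opnorm (B i))\<^sup>2)" unfolding a_def by (rule Min_in) auto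
  then obtain i\<^sub>0 where "a = \<bar>det (B i\<^sub>0)\<bar> / (opnorm (B i\<^sub>0))\<^sup>2" by blast
  then have a: "0 < a" using zero_less_power[OF opnorm_pos[OF dB[of i\<^sub>0]], of 2] dB by simp
  have a_le: "a * opnorm (B i) * norm y \<le> norm (B i *v y)" for i y
  proof -
    have p: "0 < opnorm (B i)" by (rule opnorm_pos[OF dB])
    have "a \<le> \<bar>det (B i)\<bar> / (opnorm (B i))\<^sup>2" unfolding a_def by (rule Min_le) auto
    then have "a * (opnorm (B i))\<^sup>2 \<le> \<bar>det (B i)\<bar>" using p by (simp add: field_simps)
    then have "a * (opnorm (B i))\<^sup>2 * norm y \<le> \<bar>det (B i)\<bar> * norm y" by (rule mult_right_mono) simp
    also have "\<dots> \<le> opnorm (B i) * norm (B i *v y)" by (rule det_mult_norm_le)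
    finally have "opnorm (B i) * (a * opnorm (B i) * norm y) \<le> opnorm (B i) * norm (B i *v y)"
      by (simp add: power2_eq_square algebra_simps)
    then show ?thesis using p by simp
  qed
  \<comment> \<open>The bound 1 serves the empty word.\<close>
  define \<kappa> where "\<kappa> = min 1 (\<delta> / c * a)"
  show ?thesis
  proof (rule that)
    show "0 < \<kappa>" unfolding \<kappa>_def using \<delta> c a by simp
    fix w y assume "y \<in> line_cone \<C>"
    then have y: "y \<in> D" by (simp add: D_def)
    show "\<kappa> * opnorm (word_transposes A w) * norm y \<le> norm (word_transposes A w *v y)"
    proof (cases w rule: rev_cases)
      case Nil
      have "\<kappa> * norm y \<le> 1 * norm y" unfolding \<kappa>_def by (intro mult_right_mono) auto
      then show ?thesis unfolding Nil using opnorm_mat_1 by simp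
    next
      case (snoc u i)
      have "\<kappa> * opnorm (word_transposes A w) * norm y
          \<le> (\<delta> / c * a) * (opnorm (word_transposes A u) * opnorm (B i)) * norm y"
        unfolding snoc word_transposes_snoc B_def[symmetric] \<kappa>_def using \<delta> c a
        by (intro mult_right_mono mult_mono opnorm_mult) (auto simp: opnorm_nonneg)
      also have "\<dots> = \<delta> / c * opnorm (word_transposes A u) * (a * opnorm (B i) * norm y)" by simp
      also have "\<dots> \<le> \<delta> / c * opnorm (word_transposes A u) * norm (B i *v y)"
        using \<delta> c opnorm_nonneg by (intro mult_left_mono a_le) auto
      also have "\<dots> \<le> norm (word_transposes A u *v (B i *v y))" by (rule step[OF y])
      also have "\<dots> = norm (word_transposes A w *v y)"
        unfolding snoc word_transposes_snoc B_def matrix_vector_mul_assoc ..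
      finally show ?thesis .
    qed
  qed
qed

section \<open>Tubes and slices\<close>

lemma orth_proj_span:
  assumes "norm e = 1" shows "orth_proj (span {e}) x = (e \<bullet> x) *\<^sub>R e"
  unfolding orth_proj_def
proof (rule the_equality)
  have ee: "e \<bullet> e = 1" using assms by (simp add: norm_eq_1)
  show "(e \<bullet> x) *\<^sub>R e \<in> span {e} \<and> (\<forall>v\<in>span {e}. orthogonal (x - (e \<bullet> x) *\<^sub>R e) v)"
    using ee by (auto simp: span_singleton orthogonal_def inner_diff_left inner_diff_right inner_commute)
  fix y assume y: "y \<in> span {e} \<and> (\<forall>v\<in>span {e}. orthogonal (x - y) v)"
  then obtain k where k: "y = k *\<^sub>R e" by (auto simp: span_singleton)
  have "orthogonal (x - y) e" using y span_base[of e "{e}"] by simp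
  then have "e \<bullet> x = k" using ee unfolding k by (simp add: orthogonal_def inner_diff_left inner_diff_right inner_commute)
  then show "y = (e \<bullet> x) *\<^sub>R e" using k by simp
qed

text \<open>The value of a \<open>distr\<close> is the measure of the preimage or the default 0, so
  the bound holds for arbitrary \<open>g\<close> and \<open>B\<close>. The natural and the
  orthogonal projection thus enter only through a measurable set containing the preimage.\<close>

lemma emeasure_distr_le: "emeasure (distr N L g) B \<le> emeasure N (g -` B \<inter> space N)"
  unfolding distr_def by (simp add: emeasure_measure_of_conv)

lemma emeasure_distr_distr_le:
  assumes "h -` (g -` B) \<subseteq> T" "T \<in> sets N"
  shows "emeasure (distr (distr N L h) L' g) B \<le> emeasure N T"
proof -
  have "emeasure (distr (distr N L h) L' g) B \<le> emeasure (distr N L h) (g -` B \<inter> space (distr N L h))"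
    by (rule emeasure_distr_le)
  also have "\<dots> \<le> emeasure N (h -` (g -` B \<inter> space (distr N L h)) \<inter> space N)"
    by (rule emeasure_distr_le)
  also have "\<dots> \<le> emeasure N T" using assms by (intro emeasure_mono) auto
  finally show ?thesis .
qed

section \<open>Quasi-multiplicativity of norm, measure and singular value ratio\<close>

locale kaenmaki_ifs = planar_ifs A t X
  for A :: "'i::finite \<Rightarrow> real^2^2" and t X +
  fixes \<C> :: "(real^2) set set" and \<mu> :: "(nat \<Rightarrow> 'i) measure" and s c \<kappa> :: real
  assumes multicone: "strongly_invariant_multicone A \<C>"
    and \<kappa>_pos: "0 < \<kappa>"
    and expansion: "y \<in> line_cone \<C> \<Longrightarrow>
        \<kappa> * opnorm (word_transposes A w) * norm y \<le> norm (word_transposes A w *v y)"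
    and dominated: "dominated A"
    and s_gt_1: "1 < s" and s_le_2: "s \<le> 2"
    and prob_\<mu>: "prob_space \<mu>"
    and sets_\<mu>: "sets \<mu> = sets symbolic_borel"
    and c_pos: "0 < c"
    and \<mu>_lower: "inverse c * singular_value_function s (word_matrix A w) \<le> measure \<mu> (cylinder w)"
    and \<mu>_upper: "measure \<mu> (cylinder w) \<le> c * singular_value_function s (word_matrix A w)"
begin

abbreviation "D \<equiv> line_cone \<C>"
abbreviation "m w \<equiv> measure \<mu> (cylinder w)"

definition \<phi> :: "'i list \<Rightarrow> real" where
  "\<phi> w = opnorm (M w) powr (2 - s) * \<bar>det (M w)\<bar> powr (s - 1)"

text \<open>Equals \<open>alpha2 / alpha1\<close> of the word matrix: the aspect ratio of a piece
  and, up to constants, the factor by which the transpose contracts angles within the cone.\<close>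

definition \<rho> :: "'i list \<Rightarrow> real" where
  "\<rho> w = \<bar>det (M w)\<bar> / (opnorm (M w))\<^sup>2"

sublocale prob_space \<mu> by (rule prob_\<mu>)

lemma \<phi>_pos: "0 < \<phi> w"
  unfolding \<phi>_def using opnorm_M_pos[of w] det_M[of w] by simp

lemma \<rho>_pos: "0 < \<rho> w"
  unfolding \<rho>_def using opnorm_M_pos[of w] det_M[of w] by simp

lemma \<phi>_le: "\<phi> w \<le> c * m w"
  using \<mu>_lower[of w] singular_value_function_eq[OF s_gt_1 s_le_2 det_M[of w]] c_pos
  by (simp add: \<phi>_def field_simps)

lemma m_le: "m w \<le> c * \<phi> w"
  using \<mu>_upper[of w] singular_value_function_eq[OF s_gt_1 s_le_2 det_M[of w]]
  by (simp add: \<phi>_def)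

lemma m_pos: "0 < m w"
proof -
  have "0 < c * m w" using \<phi>_le[of w] \<phi>_pos[of w] by linarith
  then show ?thesis using c_pos by (simp add: zero_less_mult_iff)
qed

lemma \<rho>_le_1: "\<rho> w \<le> 1"
  unfolding \<rho>_def using det_le_opnorm_sq[of "M w"] opnorm_M_pos[of w] by simp

lemma cone_nonzero: "y \<in> D \<Longrightarrow> y \<noteq> 0"
  by (simp add: line_cone_def)

lemma expansion_M: "y \<in> D \<Longrightarrow> \<kappa> * opnorm (M w) * norm y \<le> norm (transpose (M w) *v y)"
  using expansion[of y "rev w"] unfolding word_transposes_eq opnorm_transpose by simp

lemma cone_inv_M: "y \<in> D \<Longrightarrow> transpose (M w) *v y \<in> D"
  using line_cone_invariant[OF multicone det_nonzero, of y "rev w"] unfolding word_transposes_eq by simp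

lemma transpose_M_append:
  "transpose (M (u @ v)) *v y = transpose (M v) *v (transpose (M u) *v y)"
  unfolding word_matrix_append matrix_transpose_mul matrix_vector_mul_assoc ..

lemma cone_nonempty: obtains y where "y \<in> D"
proof -
  obtain V where V: "V \<in> \<C>" "V \<in> RP1"
    using multicone unfolding strongly_invariant_multicone_def by blast
  then obtain e where "norm e = 1" "V = span {e}" using RP1_obtain_unit by metis
  then have "e \<in> D" using V by (auto simp: line_cone_def)
  then show ?thesis by (rule that)
qed

text \<open>Tested on a cone vector: \<open>transpose (M u)\<close> expands it by
  \<open>opnorm (M u)\<close> up to \<open>\<kappa>\<close> and keeps it in the cone, where
  \<open>transpose (M v)\<close> expands it in the same way. Each of the two costs one
  \<open>\<kappa>\<close>.\<close>

lemma opnorm_append_ge: "\<kappa>\<^sup>2 * opnorm (M u) * opnorm (M v) \<le> opnorm (M (u @ v))"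
proof -
  obtain y where y: "y \<in> D" using cone_nonempty by blast
  have y0: "0 < norm y" using cone_nonzero[OF y] by simp
  have "\<kappa>\<^sup>2 * opnorm (M u) * opnorm (M v) * norm y
      = \<kappa> * opnorm (M v) * (\<kappa> * opnorm (M u) * norm y)" by (simp add: power2_eq_square)
  also have "\<dots> \<le> \<kappa> * opnorm (M v) * norm (transpose (M u) *v y)"
    using \<kappa>_pos opnorm_nonneg by (intro mult_left_mono expansion_M y) auto
  also have "\<dots> \<le> norm (transpose (M v) *v (transpose (M u) *v y))"
    by (intro expansion_M cone_inv_M y)
  also have "\<dots> \<le> opnorm (transpose (M (u @ v))) * norm y"
    unfolding transpose_M_append[symmetric] by (rule norm_mult_vec_le)
  finally have "\<kappa>\<^sup>2 * opnorm (M u) * opnorm (M v) * norm y \<le> opnorm (M (u @ v)) * norm y"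
    unfolding opnorm_transpose .
  then show ?thesis using y0 by simp
qed

lemma \<phi>_append_ge: "(\<kappa>\<^sup>2) powr (2 - s) * \<phi> u * \<phi> v \<le> \<phi> (u @ v)"
proof -
  have "(\<kappa>\<^sup>2 * opnorm (M u) * opnorm (M v)) powr (2 - s) \<le> opnorm (M (u @ v)) powr (2 - s)"
    using s_le_2 \<kappa>_pos opnorm_nonneg by (intro powr_mono2 opnorm_append_ge) auto
  then have "(\<kappa>\<^sup>2 * opnorm (M u) * opnorm (M v)) powr (2 - s) * \<bar>det (M (u @ v))\<bar> powr (s - 1) \<le> \<phi> (u @ v)"
    unfolding \<phi>_def by (rule mult_right_mono) simp
  then show ?thesis unfolding \<phi>_def word_matrix_append det_mul abs_mult
    using \<kappa>_pos opnorm_nonneg by (simp add: powr_mult mult_ac)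
qed

lemma m_append_ge: obtains q where "0 < q" "\<And>u v. q * m u * m v \<le> m (u @ v)"
proof
  \<comment> \<open>The factor \<open>c ^ 3\<close> pays for trading \<open>m\<close> against
    \<open>\<phi>\<close> at \<open>u\<close>, at \<open>v\<close> and at
    \<open>u @ v\<close>.\<close>
  show "0 < (\<kappa>\<^sup>2) powr (2 - s) / c ^ 3" using \<kappa>_pos c_pos by simp
  fix u v
  have "(\<kappa>\<^sup>2) powr (2 - s) / c ^ 3 * m u * m v
      \<le> (\<kappa>\<^sup>2) powr (2 - s) / c ^ 3 * (c * \<phi> u) * (c * \<phi> v)"
    using c_pos \<phi>_pos by (intro mult_mono m_le mult_nonneg_nonneg) (auto intro: less_imp_le)
  also have "\<dots> = (\<kappa>\<^sup>2) powr (2 - s) * \<phi> u * \<phi> v / c"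
    using c_pos by (simp add: power3_eq_cube)
  also have "\<dots> \<le> \<phi> (u @ v) / c" using \<phi>_append_ge c_pos by (intro divide_right_mono) auto
  also have "\<dots> \<le> m (u @ v)" using \<phi>_le[of "u @ v"] c_pos by (simp add: field_simps)
  finally show "(\<kappa>\<^sup>2) powr (2 - s) / c ^ 3 * m u * m v \<le> m (u @ v)" .
qed

lemma cylinder_measurable [measurable, simp]: "cylinder w \<in> sets \<mu>"
  unfolding sets_\<mu> by (rule cylinder_in_symbolic_borel)

lemma m_UN_words:
  assumes "\<And>q. q \<in> Q \<Longrightarrow> length q = l"
  shows "measure \<mu> (\<Union>q\<in>Q. cylinder q) = (\<Sum>q\<in>Q. m q)"
proof (rule finite_measure_finite_Union)
  show "finite Q" by (rule finite_subset[OF _ finite_words[of l]]) (use assms in auto)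
  show "disjoint_family_on cylinder Q"
    unfolding disjoint_family_on_def using disjoint_cylinders assms by metis
qed auto

lemma m_eq_sum: "m u = (\<Sum>v\<in>{v. length v = n}. m (u @ v))"
proof -
  have "m u = measure \<mu> (\<Union>v\<in>{v. length v = n}. cylinder (u @ v))" by (subst cylinder_eq_UN[of u n]) rule
  also have "\<dots> = measure \<mu> (\<Union>q\<in>(@) u ` {v. length v = n}. cylinder q)" by simp
  also have "\<dots> = (\<Sum>q\<in>(@) u ` {v. length v = n}. m q)"
    by (rule m_UN_words[where l = "length u + n"]) auto
  also have "\<dots> = (\<Sum>v\<in>{v. length v = n}. m (u @ v))"
    by (subst sum.reindex) (auto simp: inj_on_def)
  finally show ?thesis .
qed

lemma m_Nil: "m [] = 1"
proof -
  have "space \<mu> = UNIV" using sets_eq_imp_space_eq[OF sets_\<mu>] by (simp add: symbolic_borel_def space_measure_of_conv)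
  then show ?thesis using prob_space by simp
qed

text \<open>Domination in the form in which it is used: long words align the images of the cone to
  any prescribed accuracy.\<close>

lemma \<rho>_small:
  assumes "0 < \<epsilon>" obtains n where "\<And>w. n \<le> length w \<Longrightarrow> \<rho> w \<le> \<epsilon>"
proof -
  obtain C \<tau> where C: "0 < C" "0 < \<tau>" "\<tau> < 1"
      "\<And>w. alpha2 (M w) \<le> C * \<tau> ^ length w * alpha1 (M w)"
    using dominated unfolding dominated_def by blast
  have \<rho>: "\<rho> w \<le> C * \<tau> ^ length w" for w
  proof -
    have p: "0 < opnorm (M w)" by (rule opnorm_M_pos)
    have "\<bar>det (M w)\<bar> \<le> opnorm (M w) * (C * \<tau> ^ length w * opnorm (M w))"
      unfolding alpha1_mult_alpha2[symmetric] using C(4)[of w] p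
      unfolding alpha1_eq_opnorm by (intro mult_left_mono) auto
    then show ?thesis unfolding \<rho>_def using p by (simp add: power2_eq_square field_simps)
  qed
  obtain n where n: "\<tau> ^ n < \<epsilon> / C" using real_arch_pow_inv[of "\<epsilon> / C" \<tau>] assms C by auto
  have "\<rho> w \<le> \<epsilon>" if "n \<le> length w" for w
  proof -
    have "\<tau> ^ length w \<le> \<tau> ^ n" using that C by (intro power_decreasing) auto
    then have "C * \<tau> ^ length w \<le> C * \<tau> ^ n" using C(1) by (intro mult_left_mono) auto
    also have "\<dots> \<le> \<epsilon>" using n C(1) by (simp add: field_simps)
    finally show ?thesis using \<rho>[of w] by linarith
  qed
  then show ?thesis by (rule that)
qed

text \<open>Concatenation multiplies determinants and nearly multiplies norms, and
  \<open>\<rho> u \<le> 1\<close>. What matters is uniformity in \<open>u\<close>: one suffix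
  \<open>v\<close> thins the pieces of all \<open>u @ v\<close> at once.\<close>

lemma \<rho>_append_le: "\<rho> (u @ v) \<le> \<rho> v / \<kappa> ^ 4"
proof -
  have "(\<kappa>\<^sup>2 * opnorm (M u) * opnorm (M v))\<^sup>2 \<le> (opnorm (M (u @ v)))\<^sup>2"
    using \<kappa>_pos opnorm_nonneg by (intro power_mono opnorm_append_ge) auto
  then have "\<rho> (u @ v) \<le> \<bar>det (M (u @ v))\<bar> / (\<kappa>\<^sup>2 * opnorm (M u) * opnorm (M v))\<^sup>2"
    unfolding \<rho>_def using \<kappa>_pos opnorm_M_pos
    by (intro divide_left_mono mult_pos_pos zero_less_power) auto
  also have "\<dots> = \<rho> u * \<rho> v / \<kappa> ^ 4"
    unfolding \<rho>_def word_matrix_append det_mul by (simp add: power_mult_distrib abs_mult)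
  also have "\<dots> \<le> \<rho> v / \<kappa> ^ 4"
    using \<rho>_le_1[of u] \<rho>_pos[of v] \<kappa>_pos by (intro divide_right_mono) (auto simp: mult_left_le_one_le less_imp_le)
  finally show ?thesis .
qed

text \<open>The slab is cut into strips of width \<open>\<rho> w\<close>, the ratio of the singular values: their images
  have diameter comparable to the smaller singular value.\<close>

lemma slab_cover:
  assumes R: "0 < R" "\<And>x y. x \<in> X \<Longrightarrow> y \<in> X \<Longrightarrow> norm (x - y) \<le> R"
    and y: "y \<in> D" and S: "S \<subseteq> X"
    and L: "\<And>x x'. x \<in> S \<Longrightarrow> x' \<in> S \<Longrightarrow>
      \<bar>(transpose (M w) *v y) \<bullet> (x - x')\<bar> \<le> L * norm (transpose (M w) *v y)"
    and b: "0 < b" "\<rho> w \<le> b * L"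
    and small: "opnorm (M w) * (1 + R / \<kappa>) < \<delta>"
  shows "finite_cover_le s \<delta> (f w ` S) ((2 + b) * (1 + R / \<kappa>) powr s * L * \<phi> w)"
proof (cases "S = {}")
  case True
  have "0 < b * L" using b(2) \<rho>_pos[of w] by linarith
  then have "0 \<le> L" using b(1) by (simp add: zero_less_mult_iff)
  then show ?thesis unfolding True finite_cover_le_def using b \<phi>_pos[of w]
    by (intro exI[of _ "{}"]) (auto intro!: mult_nonneg_nonneg less_imp_le)
next
  case False
  define e where "e = transpose (M w) *v y"
  \<comment> \<open>The 1 accounts for the width of a strip and \<open>R / \<kappa>\<close> for its
    length; \<open>d\<close> is \<open>H\<close> times the smaller singular value.\<close>
  define H where "H = 1 + R / \<kappa>"
  define d where "d = H * (\<bar>det (M w)\<bar> / opnorm (M w))"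
  have P: "0 < opnorm (M w)" by (rule opnorm_M_pos)
  have H: "0 < H" unfolding H_def using R \<kappa>_pos by (simp add: add_pos_pos)
  have d0: "0 \<le> d" unfolding d_def using H P by simp
  have y0: "0 < norm y" using cone_nonzero[OF y] by simp
  have eexp: "\<kappa> * opnorm (M w) * norm y \<le> norm e" unfolding e_def by (rule expansion_M[OF y])
  moreover have "0 < \<kappa> * opnorm (M w) * norm y" using \<kappa>_pos P y0 by simp
  ultimately have e0: "0 < norm e" by linarith
  have "0 < b * L" using b(2) \<rho>_pos[of w] by linarith
  then have L0: "0 < L" using b(1) by (simp add: zero_less_mult_iff)
  obtain x\<^sub>0 where x0: "x\<^sub>0 \<in> S" using False by blast
  define h where "h x = \<lfloor>(e \<bullet> (x - x\<^sub>0) / norm e + L) / \<rho> w\<rfloor>" for x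
  define K where "K = {0..\<lfloor>2 * L / \<rho> w\<rfloor>}"
  define U where "U k = f w ` {x \<in> S. h x = k}" for k
  have hK: "h x \<in> K" if "x \<in> S" for x
  proof -
    have "\<bar>e \<bullet> (x - x\<^sub>0) / norm e\<bar> \<le> L"
      using L[OF that x0] e0 unfolding e_def[symmetric] by (simp add: abs_divide field_simps)
    then have "0 \<le> e \<bullet> (x - x\<^sub>0) / norm e + L" "e \<bullet> (x - x\<^sub>0) / norm e + L \<le> 2 * L" by linarith+
    then show ?thesis unfolding h_def K_def using \<rho>_pos[of w]
      by (auto intro!: floor_mono divide_right_mono simp: less_imp_le)
  qed
  have diam: "diameter (U k) \<le> d" for k
  proof (rule diameter_le)
    show "U k \<noteq> {} \<or> 0 \<le> d" using d0 by simp
    fix p p' assume "p \<in> U k" "p' \<in> U k"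
    then obtain x x' where x: "x \<in> S" "x' \<in> S" "h x = h x'" "p = f w x" "p' = f w x'"
      unfolding U_def by auto
    define z where "z = x - x'"
    have "\<bar>(e \<bullet> (x - x\<^sub>0) / norm e + L) / \<rho> w - (e \<bullet> (x' - x\<^sub>0) / norm e + L) / \<rho> w\<bar> < 1"
      using x(3) unfolding h_def by linarith
    also have "(e \<bullet> (x - x\<^sub>0) / norm e + L) / \<rho> w - (e \<bullet> (x' - x\<^sub>0) / norm e + L) / \<rho> w
        = (e \<bullet> z) / norm e / \<rho> w"
      unfolding z_def by (simp add: inner_diff_right diff_divide_distrib add_divide_distrib)
    finally have "\<bar>e \<bullet> z\<bar> / norm e < \<rho> w" using \<rho>_pos[of w] e0 by (simp add: abs_divide field_simps)
    then have ez: "\<bar>e \<bullet> z\<bar> \<le> \<rho> w * norm e" using e0 by (simp add: field_simps)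
    have "norm e * norm (M w *v z) \<le> \<bar>e \<bullet> z\<bar> * opnorm (M w) + \<bar>det (M w)\<bar> * norm y * norm z"
      unfolding e_def by (rule norm_image_tube_le)
    also have "\<dots> \<le> \<rho> w * norm e * opnorm (M w) + \<bar>det (M w)\<bar> * norm y * R"
      unfolding z_def using ez R(2)[of x x'] x S P
      by (intro add_mono mult_right_mono mult_left_mono) (auto simp: z_def)
    also have "\<dots> \<le> \<rho> w * norm e * opnorm (M w) + \<bar>det (M w)\<bar> * (norm e / (\<kappa> * opnorm (M w))) * R"
      using eexp R(1) \<kappa>_pos P
      by (intro add_left_mono mult_right_mono mult_left_mono) (auto simp: field_simps)
    also have "\<dots> = norm e * d"
      unfolding d_def H_def \<rho>_def using P \<kappa>_pos by (simp add: field_simps power2_eq_square)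
    finally have "norm (M w *v z) \<le> d" using e0 by simp
    then show "norm (p - p') \<le> d" unfolding x(4,5) word_map_diff z_def .
  qed
  have bU: "bounded (U k)" for k
  proof (rule bounded_subset[OF compact_imp_bounded[OF compact_X]])
    show "U k \<subseteq> X" unfolding U_def using S f_image_subset[of w] by blast
  qed
  have "finite_cover_le s \<delta> (f w ` S) (real (card K) * d powr s)"
  proof (rule finite_cover_leI[where K = K and U = U])
    show "finite K" by (simp add: K_def)
    show "f w ` S \<subseteq> (\<Union>k\<in>K. U k)" unfolding U_def using hK by blast
    fix k
    have "d \<le> opnorm (M w) * H"
    proof -
      have "\<bar>det (M w)\<bar> / opnorm (M w) \<le> opnorm (M w)"
        using det_le_opnorm_sq[of "M w"] P by (simp add: power2_eq_square field_simps)
      then have "H * (\<bar>det (M w)\<bar> / opnorm (M w)) \<le> H * opnorm (M w)"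
        using H by (intro mult_left_mono) auto
      then show ?thesis unfolding d_def by (simp add: mult.commute)
    qed
    then have "diameter (U k) < \<delta>" using diam[of k] small unfolding H_def by linarith
    then show "bounded (U k) \<and> diameter (U k) < \<delta>" using bU by simp
  next
    have "(\<Sum>k\<in>K. diameter (U k) powr s) \<le> (\<Sum>k\<in>K. d powr s)"
      using diam s_gt_1 diameter_ge_0[OF bU] by (intro sum_mono powr_mono2) auto
    then show "(\<Sum>k\<in>K. diameter (U k) powr s) \<le> real (card K) * d powr s" by simp
  qed
  moreover have "real (card K) * d powr s \<le> (2 + b) * H powr s * L * \<phi> w"
  proof -
    have d_powr: "d powr s = H powr s * (\<bar>det (M w)\<bar> powr s / opnorm (M w) powr s)"
      unfolding d_def using H P by (simp add: powr_mult powr_divide)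
    have fl: "0 \<le> \<lfloor>2 * L / \<rho> w\<rfloor>" using L0 \<rho>_pos[of w] by simp
    have "real (card K) = real_of_int \<lfloor>2 * L / \<rho> w\<rfloor> + 1" unfolding K_def using fl by simp
    also have "\<dots> \<le> 2 * L / \<rho> w + 1" by simp
    \<comment> \<open>The surplus strip from rounding is absorbed by
      \<open>\<rho> w \<le> b * L\<close>.\<close>
    also have "\<dots> \<le> 2 * L / \<rho> w + b * L / \<rho> w" using b \<rho>_pos[of w] by (simp add: field_simps)
    finally have "real (card K) * d powr s \<le> (2 + b) * L / \<rho> w * d powr s"
      by (intro mult_right_mono) (simp_all add: distrib_right add_divide_distrib)
    \<comment> \<open>About \<open>L / \<rho> w\<close> strips cost \<open>alpha2 powr s\<close>
      each, up to constants. As \<open>\<rho> w\<close> is \<open>alpha2 / alpha1\<close>, the total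
      is of order \<open>L * alpha1 * alpha2 powr (s - 1)\<close>.\<close>
    also have "\<dots> = (2 + b) * H powr s * L * \<phi> w"
    proof -
      have "\<bar>det (M w)\<bar> powr s / opnorm (M w) powr s / \<rho> w
          = (\<bar>det (M w)\<bar> powr s / \<bar>det (M w)\<bar>) * ((opnorm (M w))\<^sup>2 / opnorm (M w) powr s)"
        unfolding \<rho>_def by simp
      also have "\<bar>det (M w)\<bar> powr s / \<bar>det (M w)\<bar> = \<bar>det (M w)\<bar> powr (s - 1)"
        using det_M[of w] by (simp add: powr_diff)
      also have "(opnorm (M w))\<^sup>2 / opnorm (M w) powr s = opnorm (M w) powr (2 - s)"
        using P by (simp add: powr_diff)
      finally have eq: "\<bar>det (M w)\<bar> powr s / opnorm (M w) powr s / \<rho> w = \<phi> w"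
        unfolding \<phi>_def by simp
      show ?thesis unfolding d_powr eq[symmetric] by (simp add: mult_ac)
    qed
    finally show ?thesis .
  qed
  ultimately show ?thesis unfolding H_def using finite_cover_le_mono by blast
qed

text \<open>The whole attractor is a slab of width \<open>R\<close> in any direction, with
  \<open>b = 1 / R\<close> as \<open>\<rho> w \<le> 1\<close>. The iteration below starts from this
  a priori cover.\<close>

lemma cylinder_cover:
  obtains K H where "0 < K" "0 < H"
    "\<And>w \<delta>. opnorm (M w) * H < \<delta> \<Longrightarrow> finite_cover_le s \<delta> (f w ` X) (K * m w)"
proof -
  obtain R where R: "0 < R" "\<And>x y. x \<in> X \<Longrightarrow> y \<in> X \<Longrightarrow> norm (x - y) \<le> R"
    using diameter_bound by blast
  obtain y where y: "y \<in> D" using cone_nonempty by blast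
  define H where "H = 1 + R / \<kappa>"
  define K where "K = (2 + 1 / R) * H powr s * R * c"
  have H: "0 < H" unfolding H_def using R \<kappa>_pos by (simp add: add_pos_pos)
  have K: "0 < K" unfolding K_def using H R c_pos by (simp add: add_pos_pos)
  have "finite_cover_le s \<delta> (f w ` X) (K * m w)" if "opnorm (M w) * H < \<delta>" for w \<delta>
  proof -
    have "finite_cover_le s \<delta> (f w ` X) ((2 + 1 / R) * (1 + R / \<kappa>) powr s * R * \<phi> w)"
    proof (rule slab_cover[OF R y order_refl])
      fix x x' assume x: "x \<in> X" "x' \<in> X"
      have "\<bar>(transpose (M w) *v y) \<bullet> (x - x')\<bar> \<le> norm (transpose (M w) *v y) * norm (x - x')"
        by (rule Cauchy_Schwarz_ineq2)
      also have "\<dots> \<le> norm (transpose (M w) *v y) * R" by (intro mult_left_mono R(2) x) simp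
      finally show "\<bar>(transpose (M w) *v y) \<bullet> (x - x')\<bar> \<le> R * norm (transpose (M w) *v y)"
        by (simp add: mult.commute)
    qed (use R \<rho>_le_1 that in \<open>auto simp: H_def\<close>)
    moreover have "(2 + 1 / R) * (1 + R / \<kappa>) powr s * R * \<phi> w \<le> K * m w"
    proof -
      have "(2 + 1 / R) * (1 + R / \<kappa>) powr s * R * \<phi> w
          \<le> (2 + 1 / R) * (1 + R / \<kappa>) powr s * R * (c * m w)"
        using R by (intro mult_left_mono \<phi>_le) (auto intro!: mult_nonneg_nonneg)
      then show ?thesis by (simp add: K_def H_def mult_ac)
    qed
    ultimately show ?thesis by (rule finite_cover_le_mono[OF _ order_refl])
  qed
  with K H show ?thesis by (rule that)
qed

text \<open>The tube has normal \<open>e = transpose (M v) *v x\<close>, whereas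
  \<open>slab_cover\<close> measures along \<open>g = transpose (M (u @ v)) *v y\<close>. Both leave
  the cone through \<open>transpose (M v)\<close>, which multiplies areas by
  \<open>det (M v)\<close> and lengths by at least \<open>\<kappa> * opnorm (M v)\<close>. So the
  two directions differ by at most \<open>\<rho> v / \<kappa>\<^sup>2\<close>, whatever
  \<open>u\<close> is.\<close>

lemma tube_cover:
  obtains K H where "0 < K" "0 < H"
    "\<And>x u v r a \<delta>. \<lbrakk>x \<in> D; norm (transpose (M v) *v x) = 1; 0 < r; \<rho> v \<le> r; opnorm (M (u @ v)) * H < \<delta>\<rbrakk> \<Longrightarrow>
      finite_cover_le s \<delta> (f (u @ v) ` {p \<in> X. \<bar>(transpose (M v) *v x) \<bullet> p - a\<bar> \<le> 2 * r})
        (K * r * m (u @ v))"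
proof -
  obtain R where R: "0 < R" "\<And>x y. x \<in> X \<Longrightarrow> y \<in> X \<Longrightarrow> norm (x - y) \<le> R"
    using diameter_bound by blast
  obtain y where y: "y \<in> D" using cone_nonempty by blast
  define H where "H = 1 + R / \<kappa>"
  \<comment> \<open>The width of the tube seen along \<open>g\<close>, in units of \<open>r\<close>:
    4 for the tube itself and \<open>R / \<kappa>\<^sup>2\<close> for the tilt. The constant
    \<open>b\<close> is what \<open>\<rho>_append_le\<close> makes of
    \<open>\<rho> v \<le> r\<close>.\<close>
  define J where "J = 4 + R / \<kappa>\<^sup>2"
  define b where "b = 1 / (\<kappa> ^ 4 * J)"
  define K where "K = (2 + b) * H powr s * J * c"
  have H: "0 < H" unfolding H_def using R \<kappa>_pos by (simp add: add_pos_pos)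
  have J: "0 < J" unfolding J_def using R \<kappa>_pos by (simp add: add_pos_pos)
  have b: "0 < b" unfolding b_def using \<kappa>_pos J by simp
  have K: "0 < K" unfolding K_def using H J b c_pos by (simp add: add_pos_pos)
  have "finite_cover_le s \<delta> (f (u @ v) ` {p \<in> X. \<bar>(transpose (M v) *v x) \<bullet> p - a\<bar> \<le> 2 * r})
        (K * r * m (u @ v))"
    if x: "x \<in> D" "norm (transpose (M v) *v x) = 1" and r: "0 < r" "\<rho> v \<le> r"
      and small: "opnorm (M (u @ v)) * H < \<delta>" for x u v r a \<delta>
  proof -
    define e where "e = transpose (M v) *v x"
    define S where "S = {p \<in> X. \<bar>e \<bullet> p - a\<bar> \<le> 2 * r}"
    define y' where "y' = transpose (M u) *v y"
    define g where "g = transpose (M (u @ v)) *v y"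
    have ne: "norm e = 1" unfolding e_def by (rule x(2))
    have g: "g = transpose (M v) *v y'" unfolding g_def y'_def by (rule transpose_M_append)
    have P: "0 < opnorm (M v)" by (rule opnorm_M_pos)
    have ex: "\<kappa> * opnorm (M v) * norm x \<le> 1" using expansion_M[OF x(1), of v] x(2) by simp
    have eg: "\<kappa> * opnorm (M v) * norm y' \<le> norm g"
      unfolding g y'_def by (intro expansion_M cone_inv_M y)
    have cross: "\<bar>cross2 g e\<bar> \<le> r / \<kappa>\<^sup>2 * norm g"
    proof -
      have kp: "0 < \<kappa> * opnorm (M v)" using \<kappa>_pos P by simp
      have "\<bar>cross2 g e\<bar> = \<bar>det (M v)\<bar> * \<bar>cross2 y' x\<bar>"
        unfolding g e_def cross2_mult det_transpose abs_mult ..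
      also have "\<dots> \<le> \<bar>det (M v)\<bar> * (norm y' * norm x)" by (intro mult_left_mono abs_cross2_le) simp
      also have "\<dots> \<le> \<bar>det (M v)\<bar> * (norm g / (\<kappa> * opnorm (M v)) * (1 / (\<kappa> * opnorm (M v))))"
        using eg ex kp
        by (intro mult_left_mono mult_mono) (simp_all add: pos_le_divide_eq mult.commute)
      also have "\<dots> = \<rho> v * (norm g / \<kappa>\<^sup>2)" unfolding \<rho>_def by (simp add: power2_eq_square)
      also have "\<dots> \<le> r * (norm g / \<kappa>\<^sup>2)" by (intro mult_right_mono r) simp
      finally show ?thesis by simp
    qed
    have "finite_cover_le s \<delta> (f (u @ v) ` S) ((2 + b) * (1 + R / \<kappa>) powr s * (J * r) * \<phi> (u @ v))"
    proof (rule slab_cover[OF R y])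
      show "S \<subseteq> X" unfolding S_def by blast
      show "\<rho> (u @ v) \<le> b * (J * r)"
      proof -
        have "\<rho> (u @ v) \<le> \<rho> v / \<kappa> ^ 4" by (rule \<rho>_append_le)
        also have "\<dots> \<le> r / \<kappa> ^ 4" using r by (intro divide_right_mono) auto
        also have "\<dots> = b * (J * r)" unfolding b_def using J by simp
        finally show ?thesis .
      qed
      fix p p' assume p: "p \<in> S" "p' \<in> S"
      have "\<bar>e \<bullet> p - a\<bar> \<le> 2 * r" "\<bar>e \<bullet> p' - a\<bar> \<le> 2 * r" using p by (auto simp: S_def)
      then have ep: "\<bar>e \<bullet> (p - p')\<bar> \<le> 4 * r" unfolding inner_diff_right by linarith
      have "\<bar>g \<bullet> (p - p')\<bar> \<le> norm g * \<bar>e \<bullet> (p - p')\<bar> + \<bar>cross2 g e\<bar> * norm (p - p')"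
        by (rule abs_inner_rotate_le[OF ne])
      also have "\<dots> \<le> norm g * (4 * r) + (r / \<kappa>\<^sup>2 * norm g) * R"
        using ep cross R p r by (intro add_mono mult_mono) (auto simp: S_def)
      also have "\<dots> = J * r * norm g" unfolding J_def by (simp add: algebra_simps)
      finally show "\<bar>(transpose (M (u @ v)) *v y) \<bullet> (p - p')\<bar>
          \<le> J * r * norm (transpose (M (u @ v)) *v y)" unfolding g_def .
    qed (use b small in \<open>auto simp: H_def\<close>)
    moreover have "(2 + b) * (1 + R / \<kappa>) powr s * (J * r) * \<phi> (u @ v) \<le> K * r * m (u @ v)"
    proof -
      have "(2 + b) * (1 + R / \<kappa>) powr s * (J * r) * \<phi> (u @ v)
          \<le> (2 + b) * (1 + R / \<kappa>) powr s * (J * r) * (c * m (u @ v))"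
        using b J r by (intro mult_left_mono \<phi>_le) (auto intro!: mult_nonneg_nonneg)
      then show ?thesis by (simp add: K_def H_def mult_ac)
    qed
    ultimately show ?thesis unfolding S_def e_def by (rule finite_cover_le_mono[OF _ order_refl])
  qed
  with K H show ?thesis by (rule that)
qed

text \<open>A tube carrying much more mass than its width has copies in every cylinder, each filling a
  definite proportion of the measure and covered at a price much smaller than its measure.
  Replacing parts of a cover by covers of these copies repeatedly drives the price of covering
  \<open>X\<close> down to the one of the copies.\<close>

lemma heavy_tube_improves_cover:
  assumes tube: "\<And>w. n\<^sub>0 \<le> length w \<Longrightarrow> finite_cover_le s \<delta> (f (w @ v) ` S) (k * m (w @ v))"
    and Q: "Q \<noteq> {}" "\<And>q. q \<in> Q \<Longrightarrow> length q = l" "\<And>q. q \<in> Q \<Longrightarrow> f q ` X \<subseteq> S"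
    and q\<^sub>0: "0 < q\<^sub>0" "\<And>u v. q\<^sub>0 * m u * m v \<le> m (u @ v)"
    and heavy: "k \<le> q\<^sub>0 * K' * (\<Sum>q\<in>Q. m q)" "0 < K'"
    and cyl: "\<And>w. n\<^sub>0 \<le> length w \<Longrightarrow> finite_cover_le s \<delta> (f w ` X) (K * m w)"
    and less: "K' < K''"
  shows "finite_cover_le s \<delta> X K''"
proof -
  define \<Sigma> where "\<Sigma> = (\<Sum>q\<in>Q. m q)"
  have finQ: "finite Q" by (rule finite_subset[OF _ finite_words[of l]]) (use Q in auto)
  have \<Sigma>: "0 < \<Sigma>" unfolding \<Sigma>_def using finQ Q(1) m_pos by (intro sum_pos) auto
  \<comment> \<open>A lower bound for the proportion of any cylinder filled by the copies;
    \<open>q\<^sub>0\<close> occurs twice, for appending \<open>v\<close> and then a word of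
    \<open>Q\<close>.\<close>
  define \<eta> where "\<eta> = q\<^sub>0 * q\<^sub>0 * m v * \<Sigma>"
  have \<eta>: "0 < \<eta>" unfolding \<eta>_def using q\<^sub>0 m_pos \<Sigma> by simp
  define n where "n = length v + l"
  define G where "G w = (\<Sum>q\<in>Q. m (w @ v @ q))" for w
  have G_ge: "q\<^sub>0 * \<Sigma> * m (w @ v) \<le> G w" for w
  proof -
    have "q\<^sub>0 * \<Sigma> * m (w @ v) = (\<Sum>q\<in>Q. q\<^sub>0 * m (w @ v) * m q)"
      unfolding \<Sigma>_def by (simp add: sum_distrib_left sum_distrib_right mult_ac)
    also have "\<dots> \<le> G w" unfolding G_def using q\<^sub>0(2)[of "w @ v"] by (intro sum_mono) simp
    finally show ?thesis .
  qed
  have G_ge': "\<eta> * m w \<le> G w" for w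
  proof -
    have "\<eta> * m w = q\<^sub>0 * \<Sigma> * (q\<^sub>0 * m w * m v)" by (simp add: \<eta>_def mult_ac)
    also have "\<dots> \<le> q\<^sub>0 * \<Sigma> * m (w @ v)" using q\<^sub>0 \<Sigma> by (intro mult_left_mono) auto
    finally show ?thesis using G_ge[of w] by linarith
  qed
  define Z where "Z = {p :: 'i list. length p = n} - (@) v ` Q"
  have Z: "{p. length p = n} = Z \<union> (@) v ` Q" "Z \<inter> (@) v ` Q = {}" "finite Z"
    using Q(2) finite_words[of n] by (auto simp: Z_def n_def)
  have m_split: "(\<Sum>p\<in>Z. m (w @ p)) = m w - G w" for w
  proof -
    have "m w = (\<Sum>p\<in>Z. m (w @ p)) + (\<Sum>p\<in>(@) v ` Q. m (w @ p))"
      unfolding m_eq_sum[of w n] Z(1) using Z finQ by (intro sum.union_disjoint) auto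
    also have "(\<Sum>p\<in>(@) v ` Q. m (w @ p)) = G w"
      unfolding G_def by (subst sum.reindex) (auto simp: inj_on_def)
    finally show ?thesis by simp
  qed
  have "m [] - G [] \<ge> 0" unfolding m_split[symmetric] by (intro sum_nonneg) simp
  then have \<eta>1: "\<eta> \<le> 1" using G_ge'[of "[]"] m_Nil by simp
  \<comment> \<open>One round: the remaining cylinders keep the price \<open>B\<close>, while the
    copies, filling at least the proportion \<open>\<eta>\<close>, pay at most \<open>K'\<close> per
    unit of measure.\<close>
  have step: "finite_cover_le s \<delta> (f w ` X) ((B - (B - K') * \<eta>) * m w)"
    if B: "K' \<le> B" and cov: "\<And>w. n\<^sub>0 \<le> length w \<Longrightarrow> finite_cover_le s \<delta> (f w ` X) (B * m w)"
      and w: "n\<^sub>0 \<le> length w" for B w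
  proof -
    \<comment> \<open>\<open>None\<close> stands for the copy of the tube, which covers the pieces
      of all words of \<open>Q\<close> after \<open>v\<close>; \<open>Some p\<close> stands for a
      remaining word.\<close>
    define cv where "cv = (\<lambda>p. if p = None then k * m (w @ v) else B * m (w @ the p))"
    define Sv where "Sv = (\<lambda>p. if p = None then f (w @ v) ` S else f (w @ the p) ` X)"
    have "finite_cover_le s \<delta> (\<Union>p\<in>insert None (Some ` Z). Sv p) (\<Sum>p\<in>insert None (Some ` Z). cv p)"
    proof (rule finite_cover_le_UN)
      fix p assume "p \<in> insert None (Some ` Z)"
      show "finite_cover_le s \<delta> (Sv p) (cv p)"
        using tube[OF w] cov[of "w @ the p"] w by (auto simp: Sv_def cv_def)
    qed (use Z in simp)
    moreover have "f w ` X \<subseteq> (\<Union>p\<in>insert None (Some ` Z). Sv p)"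
    proof -
      have "f (w @ v @ q) ` X \<subseteq> f (w @ v) ` S" if "q \<in> Q" for q
        using Q(3)[OF that] f_append_image[of "w @ v" q] by auto
      then show ?thesis unfolding f_image_eq_words[of w n] Z(1) Sv_def by (auto; blast)
    qed
    moreover have "(\<Sum>p\<in>insert None (Some ` Z). cv p) \<le> (B - (B - K') * \<eta>) * m w"
    proof -
      have "(\<Sum>p\<in>insert None (Some ` Z). cv p) = k * m (w @ v) + (\<Sum>p\<in>Z. B * m (w @ p))"
        using Z(3) by (simp add: cv_def sum.reindex)
      also have "(\<Sum>p\<in>Z. B * m (w @ p)) = B * (m w - G w)"
        unfolding m_split[symmetric] sum_distrib_left ..
      also have "k * m (w @ v) \<le> K' * G w"
      proof -
        have "k * m (w @ v) \<le> q\<^sub>0 * K' * \<Sigma> * m (w @ v)"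
          using heavy(1) unfolding \<Sigma>_def by (intro mult_right_mono) auto
        also have "\<dots> = K' * (q\<^sub>0 * \<Sigma> * m (w @ v))" by (simp add: mult_ac)
        also have "\<dots> \<le> K' * G w" using heavy(2) by (intro mult_left_mono G_ge) auto
        finally show ?thesis .
      qed
      also have "K' * G w + B * (m w - G w) = B * m w - (B - K') * G w" by (simp add: algebra_simps)
      also have "\<dots> \<le> B * m w - (B - K') * (\<eta> * m w)"
        using B by (intro diff_left_mono mult_left_mono G_ge') auto
      finally show ?thesis by (simp add: algebra_simps)
    qed
    ultimately show ?thesis using finite_cover_le_mono by blast
  qed
  \<comment> \<open>Solves the recursion in which each round moves the price by the fraction
    \<open>\<eta>\<close> of its distance to \<open>K'\<close>. The \<open>max\<close> makes the
    start dominate both \<open>K\<close> and \<open>K'\<close>.\<close>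
  define B where "B j = K' + (max K K' - K') * (1 - \<eta>) ^ j" for j :: nat
  have B_ge: "K' \<le> B j" for j unfolding B_def using \<eta>1 by simp
  have covB: "finite_cover_le s \<delta> (f w ` X) (B j * m w)" if "n\<^sub>0 \<le> length w" for w j
    using that
  proof (induction j arbitrary: w)
    case 0
    have "K * m w \<le> B 0 * m w" unfolding B_def by (intro mult_right_mono) auto
    then show ?case using cyl[OF 0] finite_cover_le_mono by blast
  next
    case (Suc j)
    have "B (Suc j) = B j - (B j - K') * \<eta>" unfolding B_def by (simp add: algebra_simps)
    then show ?case using step[OF B_ge[of j] Suc.IH Suc.prems] by simp
  qed
  have "\<exists>j. B j \<le> K''"
  proof -
    have lim: "(\<lambda>j. (1 - \<eta>) ^ j) \<longlonglongrightarrow> 0" using \<eta> \<eta>1 by (intro LIMSEQ_realpow_zero) auto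
    have "B \<longlonglongrightarrow> K' + (max K K' - K') * 0" unfolding B_def by (intro tendsto_add tendsto_mult tendsto_const lim)
    then have "\<forall>\<^sub>F j in sequentially. B j < K''" using less by (intro order_tendstoD) auto
    then obtain j where "B j < K''" unfolding eventually_sequentially by blast
    then show ?thesis by (intro exI[of _ j]) simp
  qed
  then obtain j where j: "B j \<le> K''" ..
  \<comment> \<open>Covers are available only from length \<open>n\<^sub>0\<close> on, so
    \<open>X\<close> is assembled at that level, where the measures add up to 1.\<close>
  have "finite_cover_le s \<delta> (\<Union>w\<in>{w. length w = n\<^sub>0}. f w ` X) (\<Sum>w\<in>{w. length w = n\<^sub>0}. B j * m w)"
    by (intro finite_cover_le_UN finite_words covB) auto
  moreover have "(\<Sum>w\<in>{w. length w = n\<^sub>0}. B j * m w) = B j"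
    using m_eq_sum[of "[]" n\<^sub>0] m_Nil by (simp add: sum_distrib_left[symmetric])
  ultimately show ?thesis unfolding X_eq_words[of n\<^sub>0, symmetric] using j finite_cover_le_mono by fastforce
qed

section \<open>Mass of tubes normal to Furstenberg directions\<close>

text \<open>The intersection over all levels is used at a level \<open>n\<close> of free choice, so
  that the word can be as long as the width of a tube demands.\<close>

lemma furstenberg_direction:
  assumes "V \<in> furstenberg_directions A \<C>" "e \<in> V" "e \<noteq> 0"
  obtains v x where "length v = n" "x \<in> D" "e = transpose (M v) *v x"
proof -
  obtain w W where w: "length w = n" "W \<in> \<C>" "V = projective_action (word_transposes A w) W"
    using assms(1) unfolding furstenberg_directions_def by blast
  obtain x where x: "x \<in> W" "e = word_transposes A w *v x"
    using assms(2) unfolding w(3) projective_action_def by blast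
  have "W \<in> RP1" using w(2) multicone unfolding strongly_invariant_multicone_def by blast
  moreover have "x \<noteq> 0" using x(2) assms(3) by auto
  ultimately have "x \<in> D" using RP1_eq_span[of W x] x(1) w(2) by (simp add: line_cone_def)
  then show ?thesis using that[of "rev w" x] w(1) x(2) by (simp add: word_transposes_eq)
qed

text \<open>Words of a common length have disjoint cylinders, so the sum is the mass of a union. The
  half-width \<open>2 * r\<close> leaves room for pieces that merely meet the tube of half-width
  \<open>r\<close>.\<close>

definition tube_measure_le :: "real \<Rightarrow> bool" where
  "tube_measure_le C \<longleftrightarrow> (\<forall>V e a r l Q. V \<in> furstenberg_directions A \<C> \<longrightarrow> e \<in> V \<longrightarrow> norm e = 1 \<longrightarrow> 0 < r \<longrightarrow>
     (\<forall>q\<in>Q. length q = l \<and> (\<forall>p\<in>f q ` X. \<bar>e \<bullet> p - a\<bar> \<le> 2 * r)) \<longrightarrow> (\<Sum>q\<in>Q. m q) \<le> C * r)"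

lemma tube_measure_leD:
  assumes "tube_measure_le C" "V \<in> furstenberg_directions A \<C>" "e \<in> V" "norm e = 1" "0 < r"
    "\<And>q. q \<in> Q \<Longrightarrow> length q = l" "\<And>q p. q \<in> Q \<Longrightarrow> p \<in> f q ` X \<Longrightarrow> \<bar>e \<bullet> p - a\<bar> \<le> 2 * r"
  shows "(\<Sum>q\<in>Q. m q) \<le> C * r"
  using assms(1)[unfolded tube_measure_le_def, rule_format, OF assms(2-5), of Q l a] assms(6,7) by blast

lemma tube_measure_bound:
  assumes pos: "0 < hausdorff_measure s X"
  obtains C where "0 < C" "tube_measure_le C"
proof -
  obtain K H where K: "0 < K" "0 < H"
    "\<And>w \<delta>. opnorm (M w) * H < \<delta> \<Longrightarrow> finite_cover_le s \<delta> (f w ` X) (K * m w)"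
    using cylinder_cover by blast
  obtain K\<^sub>1 H\<^sub>1 where K1: "0 < K\<^sub>1" "0 < H\<^sub>1"
    "\<And>x u v r a \<delta>. \<lbrakk>x \<in> D; norm (transpose (M v) *v x) = 1; 0 < r; \<rho> v \<le> r; opnorm (M (u @ v)) * H\<^sub>1 < \<delta>\<rbrakk> \<Longrightarrow>
      finite_cover_le s \<delta> (f (u @ v) ` {p \<in> X. \<bar>(transpose (M v) *v x) \<bullet> p - a\<bar> \<le> 2 * r})
        (K\<^sub>1 * r * m (u @ v))"
    using tube_cover by blast
  obtain q\<^sub>0 where q0: "0 < q\<^sub>0" "\<And>u v. q\<^sub>0 * m u * m v \<le> m (u @ v)" using m_append_ge by blast
  \<comment> \<open>The measure may be infinite, so a finite number below it is chosen. The
    iteration reaches \<open>K'\<close> only in the limit; the gap up to \<open>2 * K'\<close> lets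
    it stop.\<close>
  obtain K' where K': "0 < K'" "ennreal (2 * K') < hausdorff_measure s X"
  proof -
    obtain b where b: "0 < b" "b < hausdorff_measure s X" using dense[OF pos] by blast
    then have "b < top" using order_less_le_trans[OF b(2) top_greatest] by simp
    then obtain b' where b': "b = ennreal b'" "0 \<le> b'" by (cases b) auto
    then have "0 < b'" using b by simp
    then show ?thesis using that[of "b' / 2"] b b' by simp
  qed
  \<comment> \<open>With this choice a violation of the bound yields the hypothesis on
    \<open>k = K\<^sub>1 * r\<close> in \<open>heavy_tube_improves_cover\<close>.\<close>
  define C where "C = K\<^sub>1 / (q\<^sub>0 * K')"
  have C: "0 < C" unfolding C_def using K1 q0 K' by simp
  have "(\<Sum>q\<in>Q. m q) \<le> C * r"
    if V: "V \<in> furstenberg_directions A \<C>" "e \<in> V" "norm e = 1" and r: "0 < r"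
      and Q: "\<forall>q\<in>Q. length q = l \<and> (\<forall>p\<in>f q ` X. \<bar>e \<bullet> p - a\<bar> \<le> 2 * r)"
    for V e a r l Q
  proof (rule ccontr)
    assume "\<not> (\<Sum>q\<in>Q. m q) \<le> C * r"
    then have big: "C * r < (\<Sum>q\<in>Q. m q)" by simp
    then have Qne: "Q \<noteq> {}" using mult_pos_pos[OF C r] by auto
    \<comment> \<open>The required length of \<open>v\<close> depends only on \<open>r\<close>, so
      the same \<open>v\<close> serves every \<open>\<delta>\<close>.\<close>
    obtain n where n: "\<And>w. n \<le> length w \<Longrightarrow> \<rho> w \<le> r" using \<rho>_small[OF r] by blast
    have "e \<noteq> 0" using V(3) by auto
    then obtain v x where v: "length v = n" "x \<in> D" "e = transpose (M v) *v x"
      using furstenberg_direction[OF V(1,2)] by metis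
    define S where "S = {p \<in> X. \<bar>e \<bullet> p - a\<bar> \<le> 2 * r}"
    have "hausdorff_measure s X \<le> ennreal (2 * K')"
    proof (rule hausdorff_measure_le_finite_cover)
      fix \<delta> :: real assume \<delta>: "0 < \<delta>"
      obtain n\<^sub>0 where n0: "\<And>w. n\<^sub>0 \<le> length w \<Longrightarrow> opnorm (M w) < \<delta> / (H + H\<^sub>1)"
        using opnorm_word_small[of "\<delta> / (H + H\<^sub>1)"] \<delta> K(2) K1(2) by auto
      have small: "opnorm (M w) * H < \<delta>" "opnorm (M w) * H\<^sub>1 < \<delta>" if "n\<^sub>0 \<le> length w" for w
      proof -
        have "opnorm (M w) * (H + H\<^sub>1) < \<delta>" using n0[OF that] K(2) K1(2) by (simp add: pos_less_divide_eq)
        moreover have "0 < opnorm (M w) * H" "0 < opnorm (M w) * H\<^sub>1"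
          using K(2) K1(2) opnorm_M_pos by auto
        ultimately show "opnorm (M w) * H < \<delta>" "opnorm (M w) * H\<^sub>1 < \<delta>"
          by (simp_all add: distrib_left)
      qed
      show "finite_cover_le s \<delta> X (2 * K')"
      proof (rule heavy_tube_improves_cover[where v = v and S = S and k = "K\<^sub>1 * r" and K' = K' and K = K,
            OF _ Qne _ _ q0])
        fix w :: "'i list" assume w: "n\<^sub>0 \<le> length w"
        show "finite_cover_le s \<delta> (f (w @ v) ` S) (K\<^sub>1 * r * m (w @ v))"
          unfolding S_def v(3) using v V(3) r n[of v] small(2)[of "w @ v"] w by (intro K1(3)) auto
        show "finite_cover_le s \<delta> (f w ` X) (K * m w)" using small(1)[OF w] by (rule K(3))
      next
        fix q assume "q \<in> Q"
        then show "length q = l" "f q ` X \<subseteq> S" unfolding S_def using Q f_image_subset[of q] by blast+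
      next
        have "K\<^sub>1 * r = q\<^sub>0 * K' * (C * r)" unfolding C_def using q0 K' by simp
        also have "\<dots> \<le> q\<^sub>0 * K' * (\<Sum>q\<in>Q. m q)" using big q0 K' by (intro mult_left_mono) auto
        finally show "K\<^sub>1 * r \<le> q\<^sub>0 * K' * (\<Sum>q\<in>Q. m q)" .
      qed (use K' in auto)
    qed
    then show False using K'(2) by simp
  qed
  then have "tube_measure_le C" unfolding tube_measure_le_def by blast
  with C show ?thesis by (rule that)
qed

lemma furstenberg_direction_obtain_unit:
  assumes "V \<in> furstenberg_directions A \<C>"
  obtains e where "norm e = 1" "e \<in> V" "V = span {e}" "e \<in> D"
proof -
  obtain w W where w: "W \<in> \<C>" "V = projective_action (word_transposes A w) W"
    using assms unfolding furstenberg_directions_def by blast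
  have "W \<in> RP1" using w(1) multicone unfolding strongly_invariant_multicone_def by blast
  then obtain g where g: "norm g = 1" "W = span {g}" using RP1_obtain_unit by blast
  define h where "h = word_transposes A w *v g"
  have "g \<in> D" using g w(1) by (auto simp: line_cone_def)
  then have h: "h \<in> D" unfolding h_def using line_cone_invariant[OF multicone det_nonzero] by blast
  then have "h \<noteq> 0" by (rule cone_nonzero)
  have V: "V = span {h}" unfolding w(2) g(2) projective_action_span h_def ..
  then have "V \<in> RP1" using span_singleton_in_RP1[OF \<open>h \<noteq> 0\<close>] by simp
  then obtain e where e: "norm e = 1" "V = span {e}" using RP1_obtain_unit by blast
  have eV: "e \<in> V" unfolding e(2) by (simp add: span_base)
  have "span {e} \<in> \<C>" using h V e(2) by (simp add: line_cone_def)
  then have "e \<in> D" using e(1) by (auto simp: line_cone_def)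
  then show ?thesis using that e eV by blast
qed

lemma image_diameter_le:
  assumes "\<And>x y. x \<in> X \<Longrightarrow> y \<in> X \<Longrightarrow> norm (x - y) \<le> R" "p \<in> f w ` X" "p' \<in> f w ` X" "norm e = 1"
  shows "\<bar>e \<bullet> p - e \<bullet> p'\<bar> \<le> opnorm (M w) * R"
proof -
  obtain x x' where x: "x \<in> X" "x' \<in> X" "p = f w x" "p' = f w x'" using assms(2,3) by blast
  have "\<bar>e \<bullet> (p - p')\<bar> \<le> norm (p - p')" using Cauchy_Schwarz_ineq2[of e "p - p'"] assms(4) by simp
  also have "\<dots> \<le> opnorm (M w) * norm (x - x')"
    unfolding x(3,4) word_map_diff by (rule norm_mult_vec_le)
  also have "\<dots> \<le> opnorm (M w) * R" using assms(1) x opnorm_nonneg by (intro mult_left_mono) auto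
  finally show ?thesis by (simp add: inner_diff_right)
qed

text \<open>Pieces of diameter at most \<open>r\<close> that meet the tube over the ball lie in the
  tube of twice the width, so the tube bound applies to their cylinders at one common
  length.\<close>

lemma projection_measure_bound:
  assumes C: "tube_measure_le C"
    and V: "V \<in> furstenberg_directions A \<C>" and r: "0 < r"
  shows "measure (distr (distr \<mu> borel (natural_projection A t)) borel (orth_proj V)) (V \<inter> cball p r) \<le> C * r"
proof -
  obtain e where e: "norm e = 1" "e \<in> V" "V = span {e}" "e \<in> D"
    using furstenberg_direction_obtain_unit[OF V] by blast
  obtain R where R: "0 < R" "\<And>x y. x \<in> X \<Longrightarrow> y \<in> X \<Longrightarrow> norm (x - y) \<le> R"
    using diameter_bound by blast
  obtain l where l: "\<And>w. l \<le> length w \<Longrightarrow> opnorm (M w) < r / R"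
    using opnorm_word_small[of "r / R"] r R(1) by auto
  define a where "a = e \<bullet> p"
  define Q where "Q = {q. length q = l \<and> (\<forall>x\<in>f q ` X. \<bar>e \<bullet> x - a\<bar> \<le> 2 * r)}"
  define T where "T = (\<Union>q\<in>Q. cylinder q)"
  have finQ: "finite Q" by (rule finite_subset[OF _ finite_words[of l]]) (auto simp: Q_def)
  have "natural_projection A t -` (orth_proj V -` (V \<inter> cball p r)) \<subseteq> T"
  proof
    fix x assume "x \<in> natural_projection A t -` (orth_proj V -` (V \<inter> cball p r))"
    then have "norm (p - orth_proj V (natural_projection A t x)) \<le> r" by (simp add: dist_norm)
    define z where "z = natural_projection A t x"
    have ez: "\<bar>e \<bullet> z - a\<bar> \<le> r"
    proof -
      have "e \<bullet> orth_proj V z = e \<bullet> z"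
        unfolding e(3) orth_proj_span[OF e(1)] using e(1) by (simp add: norm_eq_1)
      then have "\<bar>e \<bullet> z - a\<bar> = \<bar>e \<bullet> (p - orth_proj V z)\<bar>"
        unfolding a_def inner_diff_right by simp
      also have "\<dots> \<le> norm (p - orth_proj V z)"
        using Cauchy_Schwarz_ineq2[of e "p - orth_proj V z"] e(1) by simp
      finally show ?thesis
        using \<open>norm (p - orth_proj V (natural_projection A t x)) \<le> r\<close> unfolding z_def by linarith
    qed
    define q where "q = prefix_word x l"
    have zq: "z \<in> f q ` X" unfolding z_def q_def by (rule natural_projection_mem)
    have "q \<in> Q"
    proof -
      have "\<bar>e \<bullet> y - a\<bar> \<le> 2 * r" if y: "y \<in> f q ` X" for y
      proof -
        have "\<bar>e \<bullet> y - e \<bullet> z\<bar> \<le> opnorm (M q) * R" by (rule image_diameter_le[OF R(2) y zq e(1)])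
        also have "\<dots> \<le> r" using l[of q] R(1) by (simp add: q_def field_simps)
        finally show ?thesis using ez by linarith
      qed
      then show ?thesis unfolding Q_def by (simp add: q_def)
    qed
    moreover have "x \<in> cylinder q" by (simp add: q_def cylinder_def)
    ultimately show "x \<in> T" unfolding T_def by blast
  qed
  then have "emeasure (distr (distr \<mu> borel (natural_projection A t)) borel (orth_proj V)) (V \<inter> cball p r)
      \<le> emeasure \<mu> T"
    by (rule emeasure_distr_distr_le) (use finQ in \<open>auto simp: T_def\<close>)
  then have "measure (distr (distr \<mu> borel (natural_projection A t)) borel (orth_proj V)) (V \<inter> cball p r)
      \<le> measure \<mu> T"
    unfolding measure_def by (rule enn2real_mono) (simp add: emeasure_eq_measure)
  also have "\<dots> = (\<Sum>q\<in>Q. m q)" unfolding T_def by (rule m_UN_words[where l = l]) (auto simp: Q_def)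
  also have "\<dots> \<le> C * r"
    by (rule tube_measure_leD[where l = l and a = a, OF C V e(2,1) r]) (auto simp: Q_def)
  finally show ?thesis .
qed

section \<open>Slices and words stopped by their norm\<close>

text \<open>The words at which the norm first drops to \<open>r\<close> or below. Fixing the norm
  rather than the length makes \<open>\<phi> w\<close> comparable to
  \<open>r * alpha2 powr (s - 1)\<close>, which turns the cost of a piece into mass divided by
  \<open>r\<close>.\<close>

definition stopping_words :: "real \<Rightarrow> 'i list set" where
  "stopping_words r = {w. opnorm (M w) \<le> r \<and> (\<forall>k<length w. r < opnorm (M (take k w)))}"

lemma finite_stopping_words:
  assumes "0 < r" obtains L where "\<And>w. w \<in> stopping_words r \<Longrightarrow> length w \<le> L" "finite (stopping_words r)"
    "X = (\<Union>w\<in>stopping_words r. f w ` X)"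
proof -
  obtain L where L: "\<And>w. L \<le> length w \<Longrightarrow> opnorm (M w) < r"
    using opnorm_word_small[OF assms] by blast
  have len: "length w \<le> L" if "w \<in> stopping_words r" for w
  proof (rule ccontr)
    assume "\<not> length w \<le> L"
    then have "L < length w" by simp
    then have "r < opnorm (M (take L w))" using that by (simp add: stopping_words_def)
    moreover have "opnorm (M (take L w)) < r" using L[of "take L w"] \<open>L < length w\<close> by simp
    ultimately show False by simp
  qed
  have fin: "finite (stopping_words r)"
    by (rule finite_subset[of _ "{w. length w \<le> L}"])
      (use len finite_lists_length_le[of "UNIV :: 'i set" L] in auto)
  have "x \<in> (\<Union>w\<in>stopping_words r. f w ` X)" if x: "x \<in> X" for x
  proof -
    obtain p where p: "length p = L" "x \<in> f p ` X"
      using subsetD[OF equalityD1[OF X_eq_words[of L]] x] by blast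
    define k where "k = (LEAST k. opnorm (M (take k p)) \<le> r)"
    have pL: "opnorm (M (take L p)) \<le> r" using L[of p] p(1) by simp
    have k1: "opnorm (M (take k p)) \<le> r" unfolding k_def by (rule LeastI) (rule pL)
    have kL: "k \<le> L" unfolding k_def by (rule Least_le) (rule pL)
    have "take k p \<in> stopping_words r"
      unfolding stopping_words_def
    proof (intro CollectI conjI k1 allI impI)
      fix j assume "j < length (take k p)"
      then have j: "j < k" by simp
      then have "r < opnorm (M (take j p))" unfolding k_def by (metis not_le not_less_Least)
      then show "r < opnorm (M (take j (take k p)))" using j by (simp add: min_def)
    qed
    moreover have "x \<in> f (take k p) ` X"
      using p(2) f_append_image_subset[of "take k p" "drop k p"] by auto
    ultimately show ?thesis by blast
  qed
  then have "X = (\<Union>w\<in>stopping_words r. f w ` X)" using f_image_subset by blast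
  with len fin show ?thesis by (rule that)
qed

text \<open>Overlapping cylinders of different words would make one word a proper prefix of the
  other, but before stopping the norm exceeds \<open>r\<close>.\<close>

lemma disjoint_stopping_cylinders: "disjoint_family_on cylinder (stopping_words r)"
proof -
  have False if w: "w \<in> stopping_words r" "w' \<in> stopping_words r" "x \<in> cylinder w" "x \<in> cylinder w'"
    and less: "length w < length w'" for w w' x
  proof -
    have "w = take (length w) w'"
      using w(3,4) less by (intro nth_equalityI) (auto simp: mem_cylinder_iff)
    then show False using w(1,2) less unfolding stopping_words_def by (metis (mono_tags, lifting) mem_Collect_eq not_le)
  qed
  then show ?thesis unfolding disjoint_family_on_def
    using disjoint_cylinders by (metis disjoint_iff linorder_neqE_nat)
qed

text \<open>One letter before stopping the norm still exceeds \<open>r\<close>, and a letter lowers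
  it at most by the factor \<open>\<kappa>\<^sup>2 * b\<close>.\<close>

lemma opnorm_stopping_word_ge:
  obtains a where "0 < a" "\<And>r w. r < 1 \<Longrightarrow> 0 < r \<Longrightarrow> w \<in> stopping_words r \<Longrightarrow> a * r \<le> opnorm (M w)"
proof -
  define b where "b = Min (range (\<lambda>i. opnorm (A i)))"
  have b: "b \<le> opnorm (A i)" for i unfolding b_def by (rule Min_le) auto
  have "b \<in> range (\<lambda>i. opnorm (A i))" unfolding b_def by (rule Min_in) auto
  then have b0: "0 < b" using opnorm_pos[OF det_nonzero] by auto
  have "\<kappa>\<^sup>2 * b * r \<le> opnorm (M w)" if r: "r < 1" "0 < r" and w: "w \<in> stopping_words r" for r w
  proof (cases w rule: rev_cases)
    \<comment> \<open>The empty word has norm 1 and is no stopping word, as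
      \<open>r < 1\<close>.\<close>
    case Nil
    then show ?thesis using w r opnorm_mat_1 by (simp add: stopping_words_def)
  next
    case (snoc u i)
    have "r < opnorm (M (take (length u) w))" using w unfolding stopping_words_def snoc
      by (auto dest: spec[of _ "length u"])
    then have ru: "r \<le> opnorm (M u)" by (simp add: snoc)
    have "\<kappa>\<^sup>2 * b * r \<le> \<kappa>\<^sup>2 * opnorm (A i) * opnorm (M u)"
      using b ru r b0 by (intro mult_mono mult_nonneg_nonneg) (auto simp: opnorm_nonneg)
    also have "\<dots> = \<kappa>\<^sup>2 * opnorm (M u) * opnorm (M [i])" by (simp add: word_matrix_Cons)
    also have "\<dots> \<le> opnorm (M w)" unfolding snoc by (rule opnorm_append_ge)
    finally show ?thesis .
  qed
  moreover have "0 < \<kappa>\<^sup>2 * b" using b0 \<kappa>_pos by simp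
  ultimately show ?thesis using that by blast
qed

lemma slice_bound:
  assumes C: "0 < C" "tube_measure_le C"
  obtains C' where "0 < C'"
    "\<And>V p. V \<in> furstenberg_directions A \<C> \<Longrightarrow> hausdorff_measure (s - 1) (X \<inter> orth_proj V -` {p}) \<le> ennreal C'"
proof -
  obtain R where R: "0 < R" "\<And>x y. x \<in> X \<Longrightarrow> y \<in> X \<Longrightarrow> norm (x - y) \<le> R"
    using diameter_bound by blast
  obtain b where b: "0 < b" "\<And>r w. r < 1 \<Longrightarrow> 0 < r \<Longrightarrow> w \<in> stopping_words r \<Longrightarrow> b * r \<le> opnorm (M w)"
    using opnorm_stopping_word_ge by blast
  \<comment> \<open>A piece costs \<open>(R / \<kappa>) powr (s - 1) * c / (b * r)\<close> per unit
    of measure and the pieces met have mass at most \<open>C * (R * r)\<close>; \<open>r\<close>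
    cancels, so the bound is the same at every scale.\<close>
  define C' where "C' = (R / \<kappa>) powr (s - 1) * c / b * (C * R)"
  have C': "0 < C'" unfolding C'_def using R \<kappa>_pos c_pos b C by simp
  have "hausdorff_measure (s - 1) (X \<inter> orth_proj V -` {p}) \<le> ennreal C'"
    if V: "V \<in> furstenberg_directions A \<C>" for V p
  proof (rule hausdorff_measure_le_finite_cover)
    fix \<delta> :: real assume \<delta>: "0 < \<delta>"
    obtain e where e: "norm e = 1" "e \<in> V" "V = span {e}" "e \<in> D"
      using furstenberg_direction_obtain_unit[OF V] by blast
    define a where "a = e \<bullet> p"
    define S where "S = X \<inter> orth_proj V -` {p}"
    have S: "e \<bullet> x = a" if "x \<in> S" for x
    proof -
      have "(e \<bullet> x) *\<^sub>R e = p" using that unfolding S_def e(3) by (simp add: orth_proj_span[OF e(1)])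
      then show ?thesis unfolding a_def using e(1) by (auto simp: norm_eq_1)
    qed
    \<comment> \<open>The bound \<open>1 / 2\<close> keeps \<open>r < 1\<close>; the other one
      brings the diameters below \<open>\<delta>\<close> with a factor 2 to spare.\<close>
    define r where "r = min (1 / 2) (\<delta> * \<kappa> / (2 * R))"
    have r: "0 < r" "r < 1" "r * (R / \<kappa>) < \<delta>"
    proof -
      show "0 < r" unfolding r_def using \<delta> \<kappa>_pos R by simp
      show "r < 1" unfolding r_def by simp
      have "r * (R / \<kappa>) \<le> \<delta> * \<kappa> / (2 * R) * (R / \<kappa>)"
        unfolding r_def using R \<kappa>_pos by (intro mult_right_mono) auto
      also have "\<dots> = \<delta> / 2" using R \<kappa>_pos by simp
      finally show "r * (R / \<kappa>) < \<delta>" using \<delta> by linarith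
    qed
    obtain L where L: "\<And>w. w \<in> stopping_words r \<Longrightarrow> length w \<le> L" "finite (stopping_words r)"
      "X = (\<Union>w\<in>stopping_words r. f w ` X)"
      using finite_stopping_words[OF r(1)] by metis
    define W where "W = {w \<in> stopping_words r. f w ` X \<inter> S \<noteq> {}}"
    have finW: "finite W" unfolding W_def using L(2) by simp
    define d where "d w = \<bar>det (M w)\<bar> * R / (\<kappa> * opnorm (M w))" for w
    have d0: "0 \<le> d w" for w
      unfolding d_def using R \<kappa>_pos opnorm_nonneg by (intro divide_nonneg_nonneg mult_nonneg_nonneg) auto
    have dle: "d w < \<delta>" if "w \<in> W" for w
    proof -
      have P: "0 < opnorm (M w)" by (rule opnorm_M_pos)
      have "d w = \<bar>det (M w)\<bar> / opnorm (M w) * (R / \<kappa>)" unfolding d_def by (simp add: mult.commute)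
      also have "\<dots> \<le> opnorm (M w) * (R / \<kappa>)"
        using det_le_opnorm_sq[of "M w"] P R \<kappa>_pos
        by (intro mult_right_mono) (auto simp: power2_eq_square field_simps)
      also have "\<dots> \<le> r * (R / \<kappa>)"
        using that R \<kappa>_pos by (intro mult_right_mono) (auto simp: W_def stopping_words_def)
      finally show ?thesis using r(3) by linarith
    qed
    have bnd: "bounded (f w ` X \<inter> S)" for w
      using bounded_subset[OF compact_imp_bounded[OF compact_X], of "f w ` X \<inter> S"] unfolding S_def by auto
    have diam: "diameter (f w ` X \<inter> S) \<le> d w" for w
    proof (rule diameter_le)
      show "f w ` X \<inter> S \<noteq> {} \<or> 0 \<le> d w" using d0 by simp
      fix q q' assume q: "q \<in> f w ` X \<inter> S" "q' \<in> f w ` X \<inter> S"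
      then obtain x x' where x: "x \<in> X" "x' \<in> X" "q = f w x" "q' = f w x'" by blast
      define z where "z = x - x'"
      have Mz: "q - q' = M w *v z" unfolding x(3,4) word_map_diff z_def ..
      \<comment> \<open>Two points of the slice differ by a vector orthogonal to \<open>e\<close>,
        so in \<open>norm_image_tube_le\<close> only the determinant term remains.\<close>
      have "(transpose (M w) *v e) \<bullet> z = e \<bullet> (q - q')"
        unfolding Mz transpose_matrix_vector dot_lmul_matrix ..
      also have "\<dots> = 0" using q S by (simp add: inner_diff_right)
      finally have "norm (transpose (M w) *v e) * norm (q - q') \<le> \<bar>det (M w)\<bar> * norm e * norm z"
        using norm_image_tube_le[of "M w" e z] unfolding Mz by simp
      moreover have "\<kappa> * opnorm (M w) * norm (q - q') \<le> norm (transpose (M w) *v e) * norm (q - q')"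
        using expansion_M[OF e(4), of w] e(1) by (intro mult_right_mono) auto
      moreover have "\<bar>det (M w)\<bar> * norm e * norm z \<le> \<bar>det (M w)\<bar> * R"
        using R(2)[OF x(1,2)] e(1) unfolding z_def by (simp add: mult_left_mono)
      ultimately have "\<kappa> * opnorm (M w) * norm (q - q') \<le> \<bar>det (M w)\<bar> * R" by linarith
      then show "norm (q - q') \<le> d w"
        unfolding d_def using \<kappa>_pos opnorm_M_pos[of w] by (simp add: pos_le_divide_eq mult.commute)
    qed
    have sum_m: "(\<Sum>w\<in>W. m w) \<le> C * (R * r)"
    proof -
      \<comment> \<open>Stopping words have various lengths, while the tube bound wants one: they
        are extended to length \<open>L\<close>.\<close>
      define P where "P = {q. length q = L \<and> (\<exists>w\<in>W. \<exists>u. q = w @ u)}"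
      have finP: "finite P" by (rule finite_subset[OF _ finite_words[of L]]) (auto simp: P_def)
      have "(\<Sum>w\<in>W. m w) = measure \<mu> (\<Union>w\<in>W. cylinder w)"
        using disjoint_stopping_cylinders[of r] finW
        by (intro finite_measure_finite_Union[symmetric]) (auto simp: W_def elim: disjoint_family_on_mono[rotated])
      also have "\<dots> \<le> measure \<mu> (\<Union>q\<in>P. cylinder q)"
      proof (rule finite_measure_mono)
        show "(\<Union>w\<in>W. cylinder w) \<subseteq> (\<Union>q\<in>P. cylinder q)"
        proof
          fix x assume "x \<in> (\<Union>w\<in>W. cylinder w)"
          then obtain w where w: "w \<in> W" "x \<in> cylinder w" by blast
          then obtain u where u: "length u = L - length w" "x \<in> cylinder (w @ u)"
            unfolding cylinder_eq_UN[of w "L - length w"] by blast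
          have "length w \<le> L" using w(1) L(1) by (simp add: W_def)
          then have "w @ u \<in> P" using u(1) w(1) by (auto simp: P_def)
          then show "x \<in> (\<Union>q\<in>P. cylinder q)" using u(2) by blast
        qed
      qed (use finP in auto)
      also have "\<dots> = (\<Sum>q\<in>P. m q)" by (rule m_UN_words[where l = L]) (simp add: P_def)
      also have "\<dots> \<le> C * (R * r)"
      proof (rule tube_measure_leD[where l = L and a = a, OF C(2) V e(2,1)])
        show "0 < R * r" using R r by simp
        show "length q = L" if "q \<in> P" for q using that by (simp add: P_def)
        fix q y assume q: "q \<in> P" "y \<in> f q ` X"
        then obtain w u where w: "w \<in> W" "q = w @ u" by (auto simp: P_def)
        then have y: "y \<in> f w ` X" using q(2) f_append_image_subset by blast
        obtain x where x: "x \<in> f w ` X" "x \<in> S" using w(1) unfolding W_def by blast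
        have "\<bar>e \<bullet> y - e \<bullet> x\<bar> \<le> opnorm (M w) * R" by (rule image_diameter_le[OF R(2) y x(1) e(1)])
        also have "\<dots> \<le> r * R" using w(1) R by (intro mult_right_mono) (auto simp: W_def stopping_words_def)
        finally show "\<bar>e \<bullet> y - a\<bar> \<le> 2 * (R * r)" using S[OF x(2)] R r by (simp add: mult.commute)
      qed
      finally show ?thesis .
    qed
    show "finite_cover_le (s - 1) \<delta> (X \<inter> orth_proj V -` {p}) C'"
    proof (rule finite_cover_leI[where K = W and U = "\<lambda>w. f w ` X \<inter> S"])
      show "finite W" by (rule finW)
      show "X \<inter> orth_proj V -` {p} \<subseteq> (\<Union>w\<in>W. f w ` X \<inter> S)"
      proof
        fix x assume x: "x \<in> X \<inter> orth_proj V -` {p}"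
        then have "x \<in> (\<Union>w\<in>stopping_words r. f w ` X)" using L(3) by blast
        then show "x \<in> (\<Union>w\<in>W. f w ` X \<inter> S)" using x unfolding W_def S_def by blast
      qed
      show "bounded (f w ` X \<inter> S) \<and> diameter (f w ` X \<inter> S) < \<delta>" if "w \<in> W" for w
        using bnd[of w] diam[of w] dle[OF that] by simp
      have "(\<Sum>w\<in>W. diameter (f w ` X \<inter> S) powr (s - 1)) \<le> (\<Sum>w\<in>W. (R / \<kappa>) powr (s - 1) * c / (b * r) * m w)"
      proof (rule sum_mono)
        fix w assume w: "w \<in> W"
        have P: "0 < opnorm (M w)" by (rule opnorm_M_pos)
        have "diameter (f w ` X \<inter> S) powr (s - 1) \<le> d w powr (s - 1)"
          using s_gt_1 diam diameter_ge_0[OF bnd] by (intro powr_mono2) auto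
        also have "d w = R / \<kappa> * (\<bar>det (M w)\<bar> / opnorm (M w))" unfolding d_def by simp
        also have "\<dots> powr (s - 1) = (R / \<kappa>) powr (s - 1) * (\<bar>det (M w)\<bar> powr (s - 1) / opnorm (M w) powr (s - 1))"
          using R \<kappa>_pos P by (simp only: powr_mult powr_divide)
        \<comment> \<open>The smaller singular value to the power \<open>s - 1\<close> is
          \<open>\<phi> w\<close> divided by the larger one.\<close>
        also have "\<bar>det (M w)\<bar> powr (s - 1) / opnorm (M w) powr (s - 1) = \<phi> w / opnorm (M w)"
        proof -
          have "opnorm (M w) powr (2 - s) * opnorm (M w) powr (s - 1) = opnorm (M w)"
            unfolding powr_add[symmetric] using P by simp
          moreover have "opnorm (M w) powr (2 - s) \<noteq> 0" using P by simp
          ultimately show ?thesis unfolding \<phi>_def by (metis mult_divide_mult_cancel_left)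
        qed
        also have "(R / \<kappa>) powr (s - 1) * (\<phi> w / opnorm (M w)) \<le> (R / \<kappa>) powr (s - 1) * (c * m w / (b * r))"
          using b w r c_pos \<phi>_le[of w] \<phi>_pos[of w] P
          by (intro mult_left_mono frac_le mult_nonneg_nonneg) (auto simp: W_def)
        finally show "diameter (f w ` X \<inter> S) powr (s - 1) \<le> (R / \<kappa>) powr (s - 1) * c / (b * r) * m w" by simp
      qed
      also have "\<dots> = (R / \<kappa>) powr (s - 1) * c / (b * r) * (\<Sum>w\<in>W. m w)"
        by (simp add: sum_distrib_left)
      also have "\<dots> \<le> (R / \<kappa>) powr (s - 1) * c / (b * r) * (C * (R * r))"
        using b r c_pos by (intro mult_left_mono sum_m) auto
      also have "\<dots> = C'" unfolding C'_def using r by simp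
      finally show "(\<Sum>w\<in>W. diameter (f w ` X \<inter> S) powr (s - 1)) \<le> C'" .
    qed
  qed
  with C' show ?thesis by (rule that)
qed

end

theorem theorem1p2:
  fixes A :: "'i::finite \<Rightarrow> real^2^2"
    and t :: "'i \<Rightarrow> real^2"
    and X :: "(real^2) set"
    and \<C> :: "(real^2) set set"
    and \<mu>\<^sub>K :: "(nat \<Rightarrow> 'i) measure"
  assumes "\<And>i. onorm (\<lambda>x. A i *v x) < 1"
    and "\<And>i. det (A i) \<noteq> 0"
    and "dominated A"
    and "1 < affinity_dimension A" and "affinity_dimension A \<le> 2"
    and "is_attractor A t X"
    and "strongly_invariant_multicone A \<C>"
    and "kaenmaki_measure A \<mu>\<^sub>K"
    and "hausdorff_measure (affinity_dimension A) X > 0"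
  shows "(\<exists>C>0. \<forall>V\<in>furstenberg_directions A \<C>. \<forall>p\<in>orth_proj V ` X. \<forall>r>0.
            measure (distr (distr \<mu>\<^sub>K borel (natural_projection A t)) borel (orth_proj V))
              (V \<inter> cball p r) \<le> C * r) \<and>
         (\<exists>C>0. \<forall>V\<in>furstenberg_directions A \<C>. \<forall>p\<in>orth_proj V ` X.
            hausdorff_measure (affinity_dimension A - 1) (X \<inter> orth_proj V -` {p}) \<le> ennreal C)"
proof -
  let ?s = "affinity_dimension A"
  obtain \<kappa> where \<kappa>: "0 < \<kappa>"
    "\<And>w y. y \<in> line_cone \<C> \<Longrightarrow>
        \<kappa> * opnorm (word_transposes A w) * norm y \<le> norm (word_transposes A w *v y)"
    using multicone_expansion[OF assms(7,2)] by blast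
  obtain c where c: "0 < c"
    "\<And>w. inverse c * singular_value_function ?s (word_matrix A w) \<le> measure \<mu>\<^sub>K (cylinder w)"
    "\<And>w. measure \<mu>\<^sub>K (cylinder w) \<le> c * singular_value_function ?s (word_matrix A w)"
    using assms(8) unfolding kaenmaki_measure_def by blast
  have \<mu>: "prob_space \<mu>\<^sub>K" "sets \<mu>\<^sub>K = sets symbolic_borel"
    using assms(8) unfolding kaenmaki_measure_def by blast+
  interpret kaenmaki_ifs A t X \<C> \<mu>\<^sub>K ?s c \<kappa>
    by (intro kaenmaki_ifs.intro planar_ifs.intro kaenmaki_ifs_axioms.intro) (fact assms \<kappa> c \<mu>)+
  obtain C where C: "0 < C" "tube_measure_le C" using tube_measure_bound[OF assms(9)] by blast
  obtain C' where C': "0 < C'" "\<And>V p. V \<in> furstenberg_directions A \<C> \<Longrightarrow>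
      hausdorff_measure (?s - 1) (X \<inter> orth_proj V -` {p}) \<le> ennreal C'"
    using slice_bound[OF C] by blast
  show ?thesis using C C' projection_measure_bound by blast
qed

end
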